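(* Let $\mathcal{C}$ and $\mathcal{C}'$ be two Quillen model categories, and let $F:\mathcal{C}\to\mathcal{C}'$ and $G:\mathcal{C}'\to\mathcal{C}$ be a pair of adjoint functors, $F$ being left adjoint to $G$. Suppose that $F$ carries weak equivalences between cofibrant objects of $\mathcal{C}$ into weak equivalences of $\mathcal{C}'$, and that $G$ carries weak equivalences between fibrant objects of $\mathcal{C}'$ into weak equivalences of $\mathcal{C}$. Then $F$ has a total left derived functor $(\mathbf{L}F,\alpha)$, $G$ has a total right derived functor $(\mathbf{R}G,\beta)$ (both with respect to the classes of weak equivalences), and the functor $\mathbf{L}F$ is a left adjoint of the functor $\mathbf{R}G$.
   Context: Quillen model category (in Quillen's original sense; neither closedness nor functoriality of factorizations is assumed): a category $\mathcal{C}$ with three classes of maps, called fibrations, cofibrations and weak equivalences, such that: (M0) $\mathcal{C}$ has finite limits and finite colimits; (M1) if $i$ is a cofibration, $p$ is a fibration, and at least one of $i,p$ is a weak equivalence, then every commutative square with $i$ on the left and $p$ on the right has a diagonal lift; (M2) every map $f$ can be factored as $f=pi$ with $i$ a cofibration and weak equivalence and $p$ a fibration, and also as $f=pi$ with $i$ a cofibration and $p$ a fibration and weak equivalence; (M3) fibrations are stable under composition and base change, cofibrations are stable under composition and cobase change, and every isomorphism is both a fibration and a cofibration; (M4) the base change of a map that is both a fibration and a weak equivalence is a weak equivalence, and the cobase change of a map that is both a cofibration and a weak equivalence is a weak equivalence; (M5) if two of $f$, $g$, $gf$ are weak equivalences then so is the third, and every isomorphism is a weak equivalence. An object $X$ is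 cofibrant if the map from the initial object to $X$ is a cofibration, and fibrant if the map from $X$ to the terminal object is a fibration. Localization: for a category $\mathcal{C}$ and a class $W$ of arrows of $\mathcal{C}$, the localization functor $P:\mathcal{C}\to W^{-1}\mathcal{C}$ sends arrows of $W$ to isomorphisms and is universal for this property: every functor $\mathcal{C}\to\mathcal{D}$ sending arrows of $W$ to isomorphisms factors uniquely through $P$. Here $W$ (resp. $W'$) is the class of weak equivalences of $\mathcal{C}$ (resp. $\mathcal{C}'$), with localization functor $P:\mathcal{C}\to W^{-1}\mathcal{C}$ (resp. $P':\mathcal{C}'\to W'^{-1}\mathcal{C}'$). Total derived functors ($\star$ denotes whiskering, juxtaposition denotes vertical composition): A total left derived functor of $F:\mathcal{C}\to\mathcal{C}'$ is a pair $(\mathbf{L}F,\alpha)$, with $\mathbf{L}F:W^{-1}\mathcal{C}\to W'^{-1}\mathcal{C}'$ a functor and $\alpha:\mathbf{L}F\circ P\to P'\circ F$ a natural transformation, such that for every functor $T:W^{-1}\mathcal{C}\to W'^{-1}\mathcal{C}'$ and every natural transformation $\gamma:T\circ P\to P'\circ F$ there is a unique natural transformation $\delta:T\to\mathbf{L}F$ with $\gamma=\alpha(\delta\star P)$. A total right derived functor of $G:\mathcal{C}'\to\mathcal{C}$ is a pair $(\mathbf{R}G,\beta)$, with $\mathbf{R}G:W'^{-1}\mathcal{C}'\to W^{-1}\mathcal{C}$ a functor and $\beta:P\circ G\to\mathbf{R}G\circ P'$ a natural transformation, such that for every functor $T:W'^{-1}\mathcal{C}'\to W^{-1}\mathcal{C}$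 and every natural transformation $\gamma:P\circ G\to T\circ P'$ there is a unique natural transformation $\delta:\mathbf{R}G\to T$ with $\gamma=(\delta\star P')\beta$. *)

theory Defs
  imports Main
begin

section \<open>Categories, functors and natural transformations\<close>

record ('o, 'a) category =
  Obj :: "'o set"
  Arr :: "'a set"
  Dom :: "'a \<Rightarrow> 'o"
  Cod :: "'a \<Rightarrow> 'o"
  Idt :: "'o \<Rightarrow> 'a"
  Comp :: "'a \<Rightarrow> 'a \<Rightarrow> 'a"  (infixl "\<cdot>\<index>" 70)

definition hom :: "('o, 'a) category \<Rightarrow> 'o \<Rightarrow> 'o \<Rightarrow> 'a set" where
  "hom C X Y = {f \<in> Arr C. Dom C f = X \<and> Cod C f = Y}"

locale category =
  fixes C :: "('o, 'a) category"
  assumes Dom_in_Obj: "f \<in> Arr C \<Longrightarrow> Dom C f \<in> Obj C"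
    and Cod_in_Obj: "f \<in> Arr C \<Longrightarrow> Cod C f \<in> Obj C"
    and Idt_in_hom: "X \<in> Obj C \<Longrightarrow> Idt C X \<in> hom C X X"
    and Comp_in_hom: "f \<in> hom C X Y \<Longrightarrow> g \<in> hom C Y Z \<Longrightarrow> g \<cdot>\<^bsub>C\<^esub> f \<in> hom C X Z"
    and Comp_Idt: "f \<in> hom C X Y \<Longrightarrow> f \<cdot>\<^bsub>C\<^esub> Idt C X = f"
    and Idt_Comp: "f \<in> hom C X Y \<Longrightarrow> Idt C Y \<cdot>\<^bsub>C\<^esub> f = f"
    and Comp_assoc: "f \<in> hom C X Y \<Longrightarrow> g \<in> hom C Y Z \<Longrightarrow> h \<in> hom C Z V \<Longrightarrow>
      h \<cdot>\<^bsub>C\<^esub> (g \<cdot>\<^bsub>C\<^esub> f) = (h \<cdot>\<^bsub>C\<^esub> g) \<cdot>\<^bsub>C\<^esub> f"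

definition is_iso :: "('o, 'a) category \<Rightarrow> 'a \<Rightarrow> bool" where
  "is_iso C f \<longleftrightarrow> f \<in> Arr C \<and>
    (\<exists>g \<in> hom C (Cod C f) (Dom C f).
      g \<cdot>\<^bsub>C\<^esub> f = Idt C (Dom C f) \<and> f \<cdot>\<^bsub>C\<^esub> g = Idt C (Cod C f))"

record ('o1, 'a1, 'o2, 'a2) fctor =
  fobj :: "'o1 \<Rightarrow> 'o2"
  farr :: "'a1 \<Rightarrow> 'a2"

definition is_functor ::
    "('o1, 'a1) category \<Rightarrow> ('o2, 'a2) category \<Rightarrow> ('o1, 'a1, 'o2, 'a2) fctor \<Rightarrow> bool" where
  "is_functor A B F \<longleftrightarrow> category A \<and> category B \<and>
    (\<forall>X \<in> Obj A. fobj F X \<in> Obj B) \<and>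
    (\<forall>f \<in> Arr A. farr F f \<in> hom B (fobj F (Dom A f)) (fobj F (Cod A f))) \<and>
    (\<forall>X \<in> Obj A. farr F (Idt A X) = Idt B (fobj F X)) \<and>
    (\<forall>f \<in> Arr A. \<forall>g \<in> Arr A. Dom A g = Cod A f \<longrightarrow>
      farr F (g \<cdot>\<^bsub>A\<^esub> f) = farr F g \<cdot>\<^bsub>B\<^esub> farr F f)"

text \<open>
  The values of a functor outside the carriers of its source are irrelevant, so equality of
  functors (and, below, uniqueness of natural transformations) means agreement on the carriers.
\<close>

definition functor_eq ::
    "('o1, 'a1) category \<Rightarrow> ('o1, 'a1, 'o2, 'a2) fctor \<Rightarrow> ('o1, 'a1, 'o2, 'a2) fctor \<Rightarrow> bool" where
  "functor_eq A F G \<longleftrightarrow>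
    (\<forall>X \<in> Obj A. fobj F X = fobj G X) \<and> (\<forall>f \<in> Arr A. farr F f = farr G f)"

definition id_fctor :: "('o, 'a, 'o, 'a) fctor" where
  "id_fctor = \<lparr>fobj = id, farr = id\<rparr>"

definition comp_fctor ::
    "('o2, 'a2, 'o3, 'a3) fctor \<Rightarrow> ('o1, 'a1, 'o2, 'a2) fctor \<Rightarrow> ('o1, 'a1, 'o3, 'a3) fctor"
    (infixl "\<circ>\<^sub>F" 55) where
  "G \<circ>\<^sub>F F = \<lparr>fobj = fobj G \<circ> fobj F, farr = farr G \<circ> farr F\<rparr>"

definition nat_trans ::
    "('o1, 'a1) category \<Rightarrow> ('o2, 'a2) category \<Rightarrow>
     ('o1, 'a1, 'o2, 'a2) fctor \<Rightarrow> ('o1, 'a1, 'o2, 'a2) fctor \<Rightarrow> ('o1 \<Rightarrow> 'a2) \<Rightarrow> bool" where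
  "nat_trans A B F G \<tau> \<longleftrightarrow> is_functor A B F \<and> is_functor A B G \<and>
    (\<forall>X \<in> Obj A. \<tau> X \<in> hom B (fobj F X) (fobj G X)) \<and>
    (\<forall>f \<in> Arr A. farr G f \<cdot>\<^bsub>B\<^esub> \<tau> (Dom A f) = \<tau> (Cod A f) \<cdot>\<^bsub>B\<^esub> farr F f)"

definition left_adjoint ::
    "('o1, 'a1) category \<Rightarrow> ('o2, 'a2) category \<Rightarrow>
     ('o1, 'a1, 'o2, 'a2) fctor \<Rightarrow> ('o2, 'a2, 'o1, 'a1) fctor \<Rightarrow> bool" where
  "left_adjoint A B F G \<longleftrightarrow> is_functor A B F \<and> is_functor B A G \<and>
    (\<exists>\<eta> \<epsilon>. nat_trans A A id_fctor (G \<circ>\<^sub>F F) \<eta> \<and> nat_trans B B (F \<circ>\<^sub>F G) id_fctor \<epsilon> \<and>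
      (\<forall>X \<in> Obj A. \<epsilon> (fobj F X) \<cdot>\<^bsub>B\<^esub> farr F (\<eta> X) = Idt B (fobj F X)) \<and>
      (\<forall>Y \<in> Obj B. farr G (\<epsilon> Y) \<cdot>\<^bsub>A\<^esub> \<eta> (fobj G Y) = Idt A (fobj G Y)))"


section \<open>Limits and colimits\<close>

definition is_cone ::
    "('j, 'k) category \<Rightarrow> ('o, 'a) category \<Rightarrow> ('j, 'k, 'o, 'a) fctor \<Rightarrow> 'o \<Rightarrow> ('j \<Rightarrow> 'a) \<Rightarrow> bool" where
  "is_cone J C D X \<pi> \<longleftrightarrow> X \<in> Obj C \<and>
    (\<forall>j \<in> Obj J. \<pi> j \<in> hom C X (fobj D j)) \<and>
    (\<forall>u \<in> Arr J. farr D u \<cdot>\<^bsub>C\<^esub> \<pi> (Dom J u) = \<pi> (Cod J u))"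

definition is_limit ::
    "('j, 'k) category \<Rightarrow> ('o, 'a) category \<Rightarrow> ('j, 'k, 'o, 'a) fctor \<Rightarrow> 'o \<Rightarrow> ('j \<Rightarrow> 'a) \<Rightarrow> bool" where
  "is_limit J C D X \<pi> \<longleftrightarrow> is_cone J C D X \<pi> \<and>
    (\<forall>Y \<rho>. is_cone J C D Y \<rho> \<longrightarrow>
      (\<exists>!h. h \<in> hom C Y X \<and> (\<forall>j \<in> Obj J. \<pi> j \<cdot>\<^bsub>C\<^esub> h = \<rho> j)))"

definition is_cocone ::
    "('j, 'k) category \<Rightarrow> ('o, 'a) category \<Rightarrow> ('j, 'k, 'o, 'a) fctor \<Rightarrow> 'o \<Rightarrow> ('j \<Rightarrow> 'a) \<Rightarrow> bool" where
  "is_cocone J C D X \<iota> \<longleftrightarrow> X \<in> Obj C \<and>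
    (\<forall>j \<in> Obj J. \<iota> j \<in> hom C (fobj D j) X) \<and>
    (\<forall>u \<in> Arr J. \<iota> (Cod J u) \<cdot>\<^bsub>C\<^esub> farr D u = \<iota> (Dom J u))"

definition is_colimit ::
    "('j, 'k) category \<Rightarrow> ('o, 'a) category \<Rightarrow> ('j, 'k, 'o, 'a) fctor \<Rightarrow> 'o \<Rightarrow> ('j \<Rightarrow> 'a) \<Rightarrow> bool" where
  "is_colimit J C D X \<iota> \<longleftrightarrow> is_cocone J C D X \<iota> \<and>
    (\<forall>Y \<rho>. is_cocone J C D Y \<rho> \<longrightarrow>
      (\<exists>!h. h \<in> hom C X Y \<and> (\<forall>j \<in> Obj J. h \<cdot>\<^bsub>C\<^esub> \<iota> j = \<rho> j)))"

text \<open>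
  Every finite category is isomorphic to one whose objects and arrows are natural numbers, so
  it is no restriction to let the index category range over \<^typ>\<open>(nat, nat) category\<close>.
\<close>

definition has_finite_limits :: "('o, 'a) category \<Rightarrow> bool" where
  "has_finite_limits C \<longleftrightarrow>
    (\<forall>(J :: (nat, nat) category) D. finite (Obj J) \<and> finite (Arr J) \<and> is_functor J C D \<longrightarrow>
      (\<exists>X \<pi>. is_limit J C D X \<pi>))"

definition has_finite_colimits :: "('o, 'a) category \<Rightarrow> bool" where
  "has_finite_colimits C \<longleftrightarrow>
    (\<forall>(J :: (nat, nat) category) D. finite (Obj J) \<and> finite (Arr J) \<and> is_functor J C D \<longrightarrow>
      (\<exists>X \<iota>. is_colimit J C D X \<iota>))"

definition is_initial :: "('o, 'a) category \<Rightarrow> 'o \<Rightarrow> bool" where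
  "is_initial C I \<longleftrightarrow> I \<in> Obj C \<and> (\<forall>X \<in> Obj C. \<exists>!f. f \<in> hom C I X)"

definition is_terminal :: "('o, 'a) category \<Rightarrow> 'o \<Rightarrow> bool" where
  "is_terminal C T \<longleftrightarrow> T \<in> Obj C \<and> (\<forall>X \<in> Obj C. \<exists>!f. f \<in> hom C X T)"

definition commutative_square :: "('o, 'a) category \<Rightarrow> 'a \<Rightarrow> 'a \<Rightarrow> 'a \<Rightarrow> 'a \<Rightarrow> bool" where
  \<comment> \<open>arguments: top, left, right, bottom; the composites from the upper left corner agree\<close>
  "commutative_square C t l r b \<longleftrightarrow>
    t \<in> Arr C \<and> l \<in> Arr C \<and> r \<in> Arr C \<and> b \<in> Arr C \<and>
    Dom C t = Dom C l \<and> Cod C t = Dom C r \<and> Cod C l = Dom C b \<and> Cod C r = Cod C b \<and>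
    r \<cdot>\<^bsub>C\<^esub> t = b \<cdot>\<^bsub>C\<^esub> l"

text \<open>In a pullback square \<open>l\<close> is the base change of \<open>r\<close> along \<open>b\<close>; in a pushout square
  \<open>r\<close> is the cobase change of \<open>l\<close> along \<open>t\<close>.\<close>

definition pullback_square :: "('o, 'a) category \<Rightarrow> 'a \<Rightarrow> 'a \<Rightarrow> 'a \<Rightarrow> 'a \<Rightarrow> bool" where
  "pullback_square C t l r b \<longleftrightarrow> commutative_square C t l r b \<and>
    (\<forall>t' l'. commutative_square C t' l' r b \<longrightarrow>
      (\<exists>!h. h \<in> hom C (Dom C t') (Dom C t) \<and> t \<cdot>\<^bsub>C\<^esub> h = t' \<and> l \<cdot>\<^bsub>C\<^esub> h = l'))"

definition pushout_square :: "('o, 'a) category \<Rightarrow> 'a \<Rightarrow> 'a \<Rightarrow> 'a \<Rightarrow> 'a \<Rightarrow> bool" where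
  "pushout_square C t l r b \<longleftrightarrow> commutative_square C t l r b \<and>
    (\<forall>r' b'. commutative_square C t l r' b' \<longrightarrow>
      (\<exists>!h. h \<in> hom C (Cod C r) (Cod C r') \<and> h \<cdot>\<^bsub>C\<^esub> r = r' \<and> h \<cdot>\<^bsub>C\<^esub> b = b'))"


section \<open>Quillen model categories\<close>

locale model_category = category C
  for C :: "('o, 'a) category" +
  fixes Fib Cof W :: "'a set"
  assumes Fib_Arr: "Fib \<subseteq> Arr C"
    and Cof_Arr: "Cof \<subseteq> Arr C"
    and W_Arr: "W \<subseteq> Arr C"
    and M0_limits: "has_finite_limits C"
    and M0_colimits: "has_finite_colimits C"
    and M1: "i \<in> Cof \<Longrightarrow> p \<in> Fib \<Longrightarrow> i \<in> W \<or> p \<in> W \<Longrightarrow> commutative_square C u i p v \<Longrightarrow>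
      \<exists>h \<in> hom C (Cod C i) (Dom C p). h \<cdot>\<^bsub>C\<^esub> i = u \<and> p \<cdot>\<^bsub>C\<^esub> h = v"
    and M2_trivial_cof: "f \<in> Arr C \<Longrightarrow>
      \<exists>i p. i \<in> Cof \<inter> W \<and> p \<in> Fib \<and> Cod C i = Dom C p \<and> f = p \<cdot>\<^bsub>C\<^esub> i"
    and M2_trivial_fib: "f \<in> Arr C \<Longrightarrow>
      \<exists>i p. i \<in> Cof \<and> p \<in> Fib \<inter> W \<and> Cod C i = Dom C p \<and> f = p \<cdot>\<^bsub>C\<^esub> i"
    and M3_Fib_comp: "f \<in> Fib \<Longrightarrow> g \<in> Fib \<Longrightarrow> Cod C f = Dom C g \<Longrightarrow> g \<cdot>\<^bsub>C\<^esub> f \<in> Fib"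
    and M3_Fib_base: "pullback_square C t l r b \<Longrightarrow> r \<in> Fib \<Longrightarrow> l \<in> Fib"
    and M3_Cof_comp: "f \<in> Cof \<Longrightarrow> g \<in> Cof \<Longrightarrow> Cod C f = Dom C g \<Longrightarrow> g \<cdot>\<^bsub>C\<^esub> f \<in> Cof"
    and M3_Cof_cobase: "pushout_square C t l r b \<Longrightarrow> l \<in> Cof \<Longrightarrow> r \<in> Cof"
    and M3_iso: "is_iso C f \<Longrightarrow> f \<in> Fib \<inter> Cof"
    and M4_base: "pullback_square C t l r b \<Longrightarrow> r \<in> Fib \<inter> W \<Longrightarrow> l \<in> W"
    and M4_cobase: "pushout_square C t l r b \<Longrightarrow> l \<in> Cof \<inter> W \<Longrightarrow> r \<in> W"
    and M5_comp: "f \<in> Arr C \<Longrightarrow> g \<in> Arr C \<Longrightarrow> Cod C f = Dom C g \<Longrightarrow>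
      f \<in> W \<Longrightarrow> g \<in> W \<Longrightarrow> g \<cdot>\<^bsub>C\<^esub> f \<in> W"
    and M5_left: "f \<in> Arr C \<Longrightarrow> g \<in> Arr C \<Longrightarrow> Cod C f = Dom C g \<Longrightarrow>
      f \<in> W \<Longrightarrow> g \<cdot>\<^bsub>C\<^esub> f \<in> W \<Longrightarrow> g \<in> W"
    and M5_right: "f \<in> Arr C \<Longrightarrow> g \<in> Arr C \<Longrightarrow> Cod C f = Dom C g \<Longrightarrow>
      g \<in> W \<Longrightarrow> g \<cdot>\<^bsub>C\<^esub> f \<in> W \<Longrightarrow> f \<in> W"
    and M5_iso: "is_iso C f \<Longrightarrow> f \<in> W"

text \<open>
  Initial and terminal objects exist in a model category and isomorphisms are cofibrations and
  fibrations, so it does not matter which initial or terminal object is used.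
\<close>

definition cofibrant :: "('o, 'a) category \<Rightarrow> 'a set \<Rightarrow> 'o \<Rightarrow> bool" where
  "cofibrant C Cof X \<longleftrightarrow> X \<in> Obj C \<and> (\<exists>I f. is_initial C I \<and> f \<in> hom C I X \<and> f \<in> Cof)"

definition fibrant :: "('o, 'a) category \<Rightarrow> 'a set \<Rightarrow> 'o \<Rightarrow> bool" where
  "fibrant C Fib X \<longleftrightarrow> X \<in> Obj C \<and> (\<exists>T f. is_terminal C T \<and> f \<in> hom C X T \<and> f \<in> Fib)"


section \<open>Localization and total derived functors\<close>

text \<open>
  HOL cannot quantify over types inside a formula. Hence \<open>is_localization TYPE('t) C W L P\<close>
  tests the universal property on the categories with objects in \<open>'t\<close> and arrows in
  \<open>'t \<times> 't\<close>. A localization in the unrestricted sense satisfies this for every \<open>'t\<close>, so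
  a theorem assuming it for one \<open>'t\<close> covers all unrestricted localizations. The type \<open>'t\<close>
  must not be too small: if it has one element, for instance, \<open>P\<close> need not be injective on
  objects. It is harmless as soon as the categories under consideration embed into it.
\<close>

definition is_localization ::
    "'t itself \<Rightarrow> ('o, 'a) category \<Rightarrow> 'a set \<Rightarrow>
     ('u, 'v) category \<Rightarrow> ('o, 'a, 'u, 'v) fctor \<Rightarrow> bool" where
  "is_localization (_ :: 't itself) C W L P \<longleftrightarrow>
    is_functor C L P \<and> (\<forall>w \<in> W. is_iso L (farr P w)) \<and>
    (\<forall>(D :: ('t, 't \<times> 't) category) F. is_functor C D F \<and> (\<forall>w \<in> W. is_iso D (farr F w)) \<longrightarrow>
      (\<exists>H. is_functor L D H \<and> functor_eq C (H \<circ>\<^sub>F P) F \<and>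
        (\<forall>H'. is_functor L D H' \<and> functor_eq C (H' \<circ>\<^sub>F P) F \<longrightarrow> functor_eq L H' H)))"

definition is_total_left_derived ::
    "('o1, 'a1) category \<Rightarrow> ('u1, 'v1) category \<Rightarrow> ('o1, 'a1, 'u1, 'v1) fctor \<Rightarrow>
     ('o2, 'a2) category \<Rightarrow> ('u2, 'v2) category \<Rightarrow> ('o2, 'a2, 'u2, 'v2) fctor \<Rightarrow>
     ('o1, 'a1, 'o2, 'a2) fctor \<Rightarrow> ('u1, 'v1, 'u2, 'v2) fctor \<Rightarrow> ('o1 \<Rightarrow> 'v2) \<Rightarrow> bool" where
  "is_total_left_derived C L P C' L' P' F LF \<alpha> \<longleftrightarrow>
    is_functor L L' LF \<and> nat_trans C L' (LF \<circ>\<^sub>F P) (P' \<circ>\<^sub>F F) \<alpha> \<and>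
    (\<forall>T \<gamma>. is_functor L L' T \<and> nat_trans C L' (T \<circ>\<^sub>F P) (P' \<circ>\<^sub>F F) \<gamma> \<longrightarrow>
      (\<exists>\<delta>. nat_trans L L' T LF \<delta> \<and>
        (\<forall>X \<in> Obj C. \<gamma> X = \<alpha> X \<cdot>\<^bsub>L'\<^esub> \<delta> (fobj P X)) \<and>
        (\<forall>\<delta>'. nat_trans L L' T LF \<delta>' \<and>
          (\<forall>X \<in> Obj C. \<gamma> X = \<alpha> X \<cdot>\<^bsub>L'\<^esub> \<delta>' (fobj P X)) \<longrightarrow>
          (\<forall>X \<in> Obj L. \<delta>' X = \<delta> X))))"

definition is_total_right_derived ::
    "('o1, 'a1) category \<Rightarrow> ('u1, 'v1) category \<Rightarrow> ('o1, 'a1, 'u1, 'v1) fctor \<Rightarrow>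
     ('o2, 'a2) category \<Rightarrow> ('u2, 'v2) category \<Rightarrow> ('o2, 'a2, 'u2, 'v2) fctor \<Rightarrow>
     ('o1, 'a1, 'o2, 'a2) fctor \<Rightarrow> ('u1, 'v1, 'u2, 'v2) fctor \<Rightarrow> ('o1 \<Rightarrow> 'v2) \<Rightarrow> bool" where
  "is_total_right_derived C L P C' L' P' G RG \<beta> \<longleftrightarrow>
    is_functor L L' RG \<and> nat_trans C L' (P' \<circ>\<^sub>F G) (RG \<circ>\<^sub>F P) \<beta> \<and>
    (\<forall>T \<gamma>. is_functor L L' T \<and> nat_trans C L' (P' \<circ>\<^sub>F G) (T \<circ>\<^sub>F P) \<gamma> \<longrightarrow>
      (\<exists>\<delta>. nat_trans L L' RG T \<delta> \<and>
        (\<forall>X \<in> Obj C. \<gamma> X = \<delta> (fobj P X) \<cdot>\<^bsub>L'\<^esub> \<beta> X) \<and>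
        (\<forall>\<delta>'. nat_trans L L' RG T \<delta>' \<and>
          (\<forall>X \<in> Obj C. \<gamma> X = \<delta>' (fobj P X) \<cdot>\<^bsub>L'\<^esub> \<beta> X) \<longrightarrow>
          (\<forall>X \<in> Obj L. \<delta>' X = \<delta> X))))"

end

(* Cofibrant replacements Q X -> X are trivial fibrations, so any two lifts QX -> QY of a map
   X -> Y are left homotopic, and a functor inverting weak equivalences between cofibrant objects
   does not see the difference. Hence X |-> P'F(QX) is a functor on C which inverts W, and it
   descends to LF; RG is obtained from the opposite categories. A localization is bijective on
   objects and every arrow of it is generated by images of arrows and their inverses, so natural
   transformations may be constructed over C: the derived unit at PX is the zigzag
   X <- QX -> GFQX -> GRFQX. In the triangle identity it remains to see that the two maps
   p_{QX} and Q(p_X) from QQX to QX have the same image under P'F, and they do because both lift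
   the same map to X. *)
theory Submission
  imports Defs
begin

section \<open>Categories and functors\<close>

text \<open>The universal property of a localization is available only for functors, and only into
  categories with objects and arrows in the prescribed test types. Targets of other types are
  replaced by isomorphic copies along injections; the sum type in the final statement supplies an
  injection for every carrier that occurs. Since the universal property says nothing directly about
  natural transformations, these are built and compared by hand, object by object. Factorizations
  are not functorial, so \<open>Q\<close> is merely a function on objects with unrelated choices of
  lifts; \<open>resolves\<close> therefore ties the lift of an arrow to \<open>S\<close> only
  through its value under \<open>K\<close>. The same predicate serves in the opposite categories,
  where \<open>r Y\<close> runs from \<open>Y\<close> to \<open>R Y\<close> when read in
  \<open>C'\<close>. The derived counit is then the derived unit of the opposite adjunction, and one
  triangle identity yields both. That identity is not computed with formal inverses: it is composed
  on both sides with invertible maps until the inverses cancel and only an equation between arrows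
  of \<open>C'\<close> remains.\<close>

context category
begin

lemma Idt_simps [simp]:
  assumes "X \<in> Obj C"
  shows "Idt C X \<in> Arr C" "Dom C (Idt C X) = X" "Cod C (Idt C X) = X"
  using Idt_in_hom[OF assms] by (auto simp: hom_def)

lemma Comp_simps [simp]:
  assumes "f \<in> Arr C" "g \<in> Arr C" "Dom C g = Cod C f"
  shows "g \<cdot>\<^bsub>C\<^esub> f \<in> Arr C" "Dom C (g \<cdot>\<^bsub>C\<^esub> f) = Dom C f" "Cod C (g \<cdot>\<^bsub>C\<^esub> f) = Cod C g"
  using Comp_in_hom[of f "Dom C f" "Cod C f" g "Cod C g"] assms by (auto simp: hom_def)

lemma Dom_Cod_in_Obj [simp]:
  assumes "f \<in> Arr C"
  shows "Dom C f \<in> Obj C" "Cod C f \<in> Obj C"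
  using assms Dom_in_Obj Cod_in_Obj by auto

lemma Comp_Idt_Arr [simp]:
  assumes "f \<in> Arr C"
  shows "Dom C f = X \<Longrightarrow> f \<cdot>\<^bsub>C\<^esub> Idt C X = f" "Cod C f = Y \<Longrightarrow> Idt C Y \<cdot>\<^bsub>C\<^esub> f = f"
  using assms Comp_Idt[of f "Dom C f" "Cod C f"] Idt_Comp[of f "Dom C f" "Cod C f"]
  by (auto simp: hom_def)

lemma Comp_assoc_Arr:
  assumes "f \<in> Arr C" "g \<in> Arr C" "h \<in> Arr C" "Dom C g = Cod C f" "Dom C h = Cod C g"
  shows "(h \<cdot>\<^bsub>C\<^esub> g) \<cdot>\<^bsub>C\<^esub> f = h \<cdot>\<^bsub>C\<^esub> (g \<cdot>\<^bsub>C\<^esub> f)"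
  using Comp_assoc[of f "Dom C f" "Cod C f" g "Cod C g" h "Cod C h"] assms
  by (auto simp: hom_def)

lemma is_isoE:
  assumes "is_iso C f"
  obtains g where "f \<in> Arr C" "g \<in> Arr C" "Dom C g = Cod C f" "Cod C g = Dom C f"
    "g \<cdot>\<^bsub>C\<^esub> f = Idt C (Dom C f)" "f \<cdot>\<^bsub>C\<^esub> g = Idt C (Cod C f)"
  using assms by (auto simp: is_iso_def hom_def)

lemma iso_cancel_left:
  assumes "is_iso C f" "g \<in> Arr C" "h \<in> Arr C" "Cod C g = Dom C f" "Cod C h = Dom C f"
    "f \<cdot>\<^bsub>C\<^esub> g = f \<cdot>\<^bsub>C\<^esub> h"
  shows "g = h"
proof -
  from assms(1) obtain k where k: "f \<in> Arr C" "k \<in> Arr C" "Dom C k = Cod C f" "Cod C k = Dom C f"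
    "k \<cdot>\<^bsub>C\<^esub> f = Idt C (Dom C f)" by (rule is_isoE)
  have "g = (k \<cdot>\<^bsub>C\<^esub> f) \<cdot>\<^bsub>C\<^esub> g" using assms k by simp
  also have "\<dots> = (k \<cdot>\<^bsub>C\<^esub> f) \<cdot>\<^bsub>C\<^esub> h" using assms(2-6) k(1-4) by (simp add: Comp_assoc_Arr)
  also have "\<dots> = h" using assms k by simp
  finally show ?thesis .
qed

lemma iso_cancel_right:
  assumes "is_iso C f" "g \<in> Arr C" "h \<in> Arr C" "Dom C g = Cod C f" "Dom C h = Cod C f"
    "g \<cdot>\<^bsub>C\<^esub> f = h \<cdot>\<^bsub>C\<^esub> f"
  shows "g = h"
proof -
  from assms(1) obtain k where k: "f \<in> Arr C" "k \<in> Arr C" "Dom C k = Cod C f" "Cod C k = Dom C f"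
    "f \<cdot>\<^bsub>C\<^esub> k = Idt C (Cod C f)" by (rule is_isoE)
  have "g = g \<cdot>\<^bsub>C\<^esub> (f \<cdot>\<^bsub>C\<^esub> k)" using assms k by simp
  also have "\<dots> = (g \<cdot>\<^bsub>C\<^esub> f) \<cdot>\<^bsub>C\<^esub> k" using assms k(1-4) by (subst Comp_assoc_Arr) auto
  also have "\<dots> = (h \<cdot>\<^bsub>C\<^esub> f) \<cdot>\<^bsub>C\<^esub> k" using assms by simp
  also have "\<dots> = h \<cdot>\<^bsub>C\<^esub> (f \<cdot>\<^bsub>C\<^esub> k)" using assms(2-5) k(1-4) by (subst Comp_assoc_Arr) auto
  also have "\<dots> = h" using assms k by simp
  finally show ?thesis .
qed

text \<open>Insert the identity \<open>g'\<close> after \<open>f'\<close> on the left and cancel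
  \<open>f\<close> after \<open>g\<close> on the right. This is how naturality is carried over to
  inverted arrows.\<close>

lemma inverse_square:
  assumes "f \<in> hom C X Y" "f' \<in> hom C X' Y'" "a \<in> hom C X X'" "b \<in> hom C Y Y'"
    and "f' \<cdot>\<^bsub>C\<^esub> a = b \<cdot>\<^bsub>C\<^esub> f"
    and "g \<in> hom C Y X" "f \<cdot>\<^bsub>C\<^esub> g = Idt C Y"
    and "g' \<in> hom C Y' X'" "g' \<cdot>\<^bsub>C\<^esub> f' = Idt C X'"
  shows "a \<cdot>\<^bsub>C\<^esub> g = g' \<cdot>\<^bsub>C\<^esub> b"
proof -
  have "a \<cdot>\<^bsub>C\<^esub> g = (g' \<cdot>\<^bsub>C\<^esub> f') \<cdot>\<^bsub>C\<^esub> (a \<cdot>\<^bsub>C\<^esub> g)" using assms by (auto simp: hom_def)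
  also have "\<dots> = g' \<cdot>\<^bsub>C\<^esub> ((f' \<cdot>\<^bsub>C\<^esub> a) \<cdot>\<^bsub>C\<^esub> g)"
    using assms(1-4,6,8) by (auto simp: hom_def Comp_assoc_Arr)
  also have "\<dots> = g' \<cdot>\<^bsub>C\<^esub> (b \<cdot>\<^bsub>C\<^esub> (f \<cdot>\<^bsub>C\<^esub> g))"
    unfolding assms(5) using assms(1-4,6,8) by (auto simp: hom_def Comp_assoc_Arr)
  also have "\<dots> = g' \<cdot>\<^bsub>C\<^esub> b" using assms by (auto simp: hom_def)
  finally show ?thesis .
qed

end

lemma is_functor_category: "is_functor A B F \<Longrightarrow> category A" "is_functor A B F \<Longrightarrow> category B"
  by (auto simp: is_functor_def)

lemma functor_simps:
  assumes "is_functor A B F"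
  shows "X \<in> Obj A \<Longrightarrow> fobj F X \<in> Obj B"
    "f \<in> Arr A \<Longrightarrow> farr F f \<in> Arr B"
    "f \<in> Arr A \<Longrightarrow> Dom B (farr F f) = fobj F (Dom A f)"
    "f \<in> Arr A \<Longrightarrow> Cod B (farr F f) = fobj F (Cod A f)"
    "X \<in> Obj A \<Longrightarrow> farr F (Idt A X) = Idt B (fobj F X)"
    "f \<in> Arr A \<Longrightarrow> g \<in> Arr A \<Longrightarrow> Dom A g = Cod A f \<Longrightarrow>
      farr F (g \<cdot>\<^bsub>A\<^esub> f) = farr F g \<cdot>\<^bsub>B\<^esub> farr F f"
  using assms by (auto simp: is_functor_def hom_def)

lemma is_functorI:
  assumes "category A" "category B"
    and "\<And>X. X \<in> Obj A \<Longrightarrow> fobj F X \<in> Obj B"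
    and "\<And>f. f \<in> Arr A \<Longrightarrow> farr F f \<in> Arr B"
    and "\<And>f. f \<in> Arr A \<Longrightarrow> Dom B (farr F f) = fobj F (Dom A f)"
    and "\<And>f. f \<in> Arr A \<Longrightarrow> Cod B (farr F f) = fobj F (Cod A f)"
    and "\<And>X. X \<in> Obj A \<Longrightarrow> farr F (Idt A X) = Idt B (fobj F X)"
    and "\<And>f g. f \<in> Arr A \<Longrightarrow> g \<in> Arr A \<Longrightarrow> Dom A g = Cod A f \<Longrightarrow>
      farr F (g \<cdot>\<^bsub>A\<^esub> f) = farr F g \<cdot>\<^bsub>B\<^esub> farr F f"
  shows "is_functor A B F"
  using assms by (auto simp: is_functor_def hom_def)

lemma categoryI:
  assumes "\<And>f. f \<in> Arr C \<Longrightarrow> Dom C f \<in> Obj C \<and> Cod C f \<in> Obj C"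
    and "\<And>X. X \<in> Obj C \<Longrightarrow> Idt C X \<in> Arr C \<and> Dom C (Idt C X) = X \<and> Cod C (Idt C X) = X"
    and "\<And>f g. f \<in> Arr C \<Longrightarrow> g \<in> Arr C \<Longrightarrow> Dom C g = Cod C f \<Longrightarrow>
      g \<cdot>\<^bsub>C\<^esub> f \<in> Arr C \<and> Dom C (g \<cdot>\<^bsub>C\<^esub> f) = Dom C f \<and> Cod C (g \<cdot>\<^bsub>C\<^esub> f) = Cod C g"
    and "\<And>f. f \<in> Arr C \<Longrightarrow> f \<cdot>\<^bsub>C\<^esub> Idt C (Dom C f) = f \<and> Idt C (Cod C f) \<cdot>\<^bsub>C\<^esub> f = f"
    and "\<And>f g h. f \<in> Arr C \<Longrightarrow> g \<in> Arr C \<Longrightarrow> h \<in> Arr C \<Longrightarrow>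
      Dom C g = Cod C f \<Longrightarrow> Dom C h = Cod C g \<Longrightarrow>
      h \<cdot>\<^bsub>C\<^esub> (g \<cdot>\<^bsub>C\<^esub> f) = (h \<cdot>\<^bsub>C\<^esub> g) \<cdot>\<^bsub>C\<^esub> f"
  shows "category C"
  by unfold_locales (use assms in \<open>auto simp: hom_def\<close>)

lemma comp_fctor_simps [simp]:
  "fobj (G \<circ>\<^sub>F F) X = fobj G (fobj F X)" "farr (G \<circ>\<^sub>F F) f = farr G (farr F f)"
  by (simp_all add: comp_fctor_def)

lemma id_fctor_simps [simp]: "fobj id_fctor X = X" "farr id_fctor f = f"
  by (simp_all add: id_fctor_def)

lemma is_functor_comp: "is_functor A B F \<Longrightarrow> is_functor B D G \<Longrightarrow> is_functor A D (G \<circ>\<^sub>F F)"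
  by (rule is_functorI) (auto simp: functor_simps is_functor_category)

lemma is_functor_id: "category A \<Longrightarrow> is_functor A A id_fctor"
  by (rule is_functorI) auto

lemma functor_is_iso:
  assumes "is_functor A B F" "is_iso A f"
  shows "is_iso B (farr F f)"
proof -
  interpret A: category A using assms(1) by (rule is_functor_category)
  from assms(2) obtain g where g: "f \<in> Arr A" "g \<in> Arr A" "Dom A g = Cod A f" "Cod A g = Dom A f"
    "g \<cdot>\<^bsub>A\<^esub> f = Idt A (Dom A f)" "f \<cdot>\<^bsub>A\<^esub> g = Idt A (Cod A f)" by (rule A.is_isoE)
  note s = functor_simps[OF assms(1)]
  have "farr F g \<cdot>\<^bsub>B\<^esub> farr F f = Idt B (fobj F (Dom A f))"
    "farr F f \<cdot>\<^bsub>B\<^esub> farr F g = Idt B (fobj F (Cod A f))"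
    using g by (simp_all add: s flip: s(6))
  then show ?thesis using g unfolding is_iso_def hom_def
    by (intro conjI bexI[of _ "farr F g"]) (auto simp: s)
qed

lemma nat_trans_simps:
  assumes "nat_trans A B F G \<tau>"
  shows "X \<in> Obj A \<Longrightarrow> \<tau> X \<in> Arr B" "X \<in> Obj A \<Longrightarrow> Dom B (\<tau> X) = fobj F X"
    "X \<in> Obj A \<Longrightarrow> Cod B (\<tau> X) = fobj G X"
    "f \<in> Arr A \<Longrightarrow> farr G f \<cdot>\<^bsub>B\<^esub> \<tau> (Dom A f) = \<tau> (Cod A f) \<cdot>\<^bsub>B\<^esub> farr F f"
  using assms by (auto simp: nat_trans_def hom_def)


section \<open>Opposite categories\<close>

text \<open>The carriers stay the same, so functors and families of components are literally their
  own duals and the double opposite is the original record. Dualizing a statement becomes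
  rewriting.\<close>

definition op_cat :: "('o, 'a) category \<Rightarrow> ('o, 'a) category" where
  "op_cat C = \<lparr>Obj = Obj C, Arr = Arr C, Dom = Cod C, Cod = Dom C, Idt = Idt C,
    Comp = (\<lambda>f g. g \<cdot>\<^bsub>C\<^esub> f)\<rparr>"

lemma op_cat_simps [simp]:
  "Obj (op_cat C) = Obj C" "Arr (op_cat C) = Arr C" "Dom (op_cat C) = Cod C"
  "Cod (op_cat C) = Dom C" "Idt (op_cat C) = Idt C" "f \<cdot>\<^bsub>op_cat C\<^esub> g = g \<cdot>\<^bsub>C\<^esub> f"
  "hom (op_cat C) X Y = hom C Y X" "op_cat (op_cat C) = C"
  by (auto simp: op_cat_def hom_def)

lemma category_op [simp]:
  fixes C :: "('o, 'a) category"
  shows "category (op_cat C) \<longleftrightarrow> category C"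
proof -
  have "category (op_cat D)" if "category D" for D :: "('o, 'a) category"
  proof -
    interpret category D by fact
    show ?thesis by (rule categoryI) (auto simp: Comp_assoc_Arr)
  qed
  from this[of C] this[of "op_cat C"] show ?thesis by auto
qed

lemma is_iso_op [simp]: "is_iso (op_cat C) f \<longleftrightarrow> is_iso C f"
  by (auto simp: is_iso_def)

lemma is_functor_op [simp]: "is_functor (op_cat A) (op_cat B) F \<longleftrightarrow> is_functor A B F"
  by (auto simp: is_functor_def hom_def)

lemma is_functor_op': "is_functor (op_cat A) B F \<longleftrightarrow> is_functor A (op_cat B) F"
  by (auto simp: is_functor_def hom_def)

lemma functor_eq_op [simp]: "functor_eq (op_cat A) F G \<longleftrightarrow> functor_eq A F G"
  by (auto simp: functor_eq_def)

lemma nat_trans_op [simp]: "nat_trans (op_cat A) (op_cat B) F G \<tau> \<longleftrightarrow> nat_trans A B G F \<tau>"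
  unfolding nat_trans_def is_functor_op op_cat_simps by metis

lemma is_total_left_derived_op:
  "is_total_left_derived (op_cat C) (op_cat L) P (op_cat C') (op_cat L') P' F T \<alpha> \<longleftrightarrow>
    is_total_right_derived C L P C' L' P' F T \<alpha>"
  unfolding is_total_left_derived_def is_total_right_derived_def nat_trans_op is_functor_op
    op_cat_simps ..

text \<open>The opposite of a test category has the same types and is again a test category, so
  testing \<open>op_cat L\<close> against \<open>D\<close> amounts to testing \<open>L\<close>
  against \<open>op_cat D\<close>.\<close>

lemma is_localization_op:
  assumes "is_localization TYPE('t) C W L P"
  shows "is_localization TYPE('t) (op_cat C) W (op_cat L) P"
  unfolding is_localization_def
proof (intro conjI allI impI)
  show "is_functor (op_cat C) (op_cat L) P" "\<forall>w\<in>W. is_iso (op_cat L) (farr P w)"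
    using assms by (auto simp: is_localization_def)
next
  fix D :: "('t, 't \<times> 't) category" and F
  assume "is_functor (op_cat C) D F \<and> (\<forall>w\<in>W. is_iso D (farr F w))"
  then have "is_functor C (op_cat D) F \<and> (\<forall>w\<in>W. is_iso (op_cat D) (farr F w))"
    by (simp add: is_functor_op')
  with assms show "\<exists>H. is_functor (op_cat L) D H \<and> functor_eq (op_cat C) (H \<circ>\<^sub>F P) F \<and>
      (\<forall>H'. is_functor (op_cat L) D H' \<and> functor_eq (op_cat C) (H' \<circ>\<^sub>F P) F \<longrightarrow>
        functor_eq (op_cat L) H' H)"
    unfolding is_localization_def is_functor_op' functor_eq_op by blast
qed

section \<open>Duality for limits, squares and model structures\<close>

lemma is_cone_op: "is_cone J (op_cat C) D X \<pi> \<longleftrightarrow> is_cocone (op_cat J) C D X \<pi>"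
  by (auto simp: is_cone_def is_cocone_def)

lemma is_limit_op: "is_limit J (op_cat C) D X \<pi> \<longleftrightarrow> is_colimit (op_cat J) C D X \<pi>"
  by (auto simp: is_limit_def is_colimit_def is_cone_op)

lemma is_colimit_op: "is_colimit J (op_cat C) D X \<pi> \<longleftrightarrow> is_limit (op_cat J) C D X \<pi>"
  using is_limit_op[of "op_cat J" "op_cat C"] by simp

lemma has_finite_limits_op: "has_finite_colimits C \<Longrightarrow> has_finite_limits (op_cat C)"
  unfolding has_finite_limits_def has_finite_colimits_def is_limit_op
  by (metis is_functor_op' op_cat_simps(1,2))

lemma has_finite_colimits_op: "has_finite_limits C \<Longrightarrow> has_finite_colimits (op_cat C)"
  unfolding has_finite_limits_def has_finite_colimits_def is_colimit_op
  by (metis is_functor_op' op_cat_simps(1,2))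

lemma commutative_square_op:
  "commutative_square (op_cat C) t l r b \<longleftrightarrow> commutative_square C b r l t"
  by (auto simp: commutative_square_def)

lemma pullback_square_op: "pullback_square (op_cat C) t l r b \<longleftrightarrow> pushout_square C b r l t"
proof -
  \<comment> \<open>After dualizing, the two definitions read the corner objects off different sides
    of the squares; commutativity identifies them.\<close>
  have "Cod C l' = Cod C t'" if "commutative_square C b r l' t'" for l' t'
    using that by (auto simp: commutative_square_def)
  then show ?thesis
    unfolding pullback_square_def pushout_square_def commutative_square_op op_cat_simps
    by (smt (verit, ccfv_threshold))
qed

lemma pushout_square_op: "pushout_square (op_cat C) t l r b \<longleftrightarrow> pullback_square C b r l t"
  using pullback_square_op[of "op_cat C" b r l t] by simp

lemma cofibrant_op: "cofibrant (op_cat C) Fib X \<longleftrightarrow> fibrant C Fib X"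
  by (auto simp: cofibrant_def fibrant_def is_initial_def is_terminal_def)

lemma model_category_op:
  assumes "model_category C Fib Cof W"
  shows "model_category (op_cat C) Cof Fib W"
proof -
  interpret model_category C Fib Cof W by fact
  have "category (op_cat C)" by (simp add: category_axioms)
  then interpret op: category "op_cat C" .
  show ?thesis
  proof (unfold_locales,
      unfold op_cat_simps is_iso_op pullback_square_op pushout_square_op commutative_square_op)
    fix i p u v
    assume "i \<in> Fib" "p \<in> Cof" "i \<in> W \<or> p \<in> W" "commutative_square C v p i u"
    then show "\<exists>h\<in>hom C (Cod C p) (Dom C i). i \<cdot>\<^bsub>C\<^esub> h = u \<and> h \<cdot>\<^bsub>C\<^esub> p = v"
      using M1[of p i v u] by blast
  next
    fix f assume "f \<in> Arr C"
    show "\<exists>i p. i \<in> Fib \<inter> W \<and> p \<in> Cof \<and> Dom C i = Cod C p \<and> f = i \<cdot>\<^bsub>C\<^esub> p"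
      using M2_trivial_fib[OF \<open>f \<in> Arr C\<close>] by metis
    show "\<exists>i p. i \<in> Fib \<and> p \<in> Cof \<inter> W \<and> Dom C i = Cod C p \<and> f = i \<cdot>\<^bsub>C\<^esub> p"
      using M2_trivial_cof[OF \<open>f \<in> Arr C\<close>] by metis
  qed (use Fib_Arr Cof_Arr W_Arr M0_limits M0_colimits M3_Fib_comp M3_Fib_base M3_Cof_comp
     M3_Cof_cobase M3_iso M4_base M4_cobase M5_comp M5_left M5_right M5_iso in
     \<open>auto simp: has_finite_limits_op has_finite_colimits_op\<close>)
qed


section \<open>Localizations\<close>

text \<open>Transport of structure along injections: an isomorphic copy of \<open>C\<close> in the
  types over which the universal property quantifies. As \<open>i\<close> and \<open>j\<close> are
  to be injective on whole types, the total \<open>inv\<close> recovers objects and arrows.\<close>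

definition map_cat :: "('o \<Rightarrow> 'p) \<Rightarrow> ('a \<Rightarrow> 'b) \<Rightarrow> ('o, 'a) category \<Rightarrow> ('p, 'b) category" where
  "map_cat i j C = \<lparr>Obj = i ` Obj C, Arr = j ` Arr C, Dom = i \<circ> Dom C \<circ> inv j,
    Cod = i \<circ> Cod C \<circ> inv j, Idt = j \<circ> Idt C \<circ> inv i,
    Comp = (\<lambda>g f. j (inv j g \<cdot>\<^bsub>C\<^esub> inv j f))\<rparr>"

lemma map_cat_category:
  assumes "category C" "inj i" "inj j"
  shows "category (map_cat i j C)"
proof -
  interpret category C by fact
  show ?thesis
    by (rule categoryI) (use assms(2,3) in \<open>auto simp: map_cat_def Comp_assoc_Arr inj_eq\<close>)
qed

lemma map_cat_functor:
  assumes "category C" "inj i" "inj j"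
  shows "is_functor C (map_cat i j C) \<lparr>fobj = i, farr = j\<rparr>"
    and "is_functor (map_cat i j C) C \<lparr>fobj = inv i, farr = inv j\<rparr>"
proof -
  interpret category C by fact
  show "is_functor C (map_cat i j C) \<lparr>fobj = i, farr = j\<rparr>"
    by (rule is_functorI[OF assms(1) map_cat_category[OF assms]])
      (use assms(2,3) in \<open>auto simp: map_cat_def inj_eq\<close>)
  show "is_functor (map_cat i j C) C \<lparr>fobj = inv i, farr = inv j\<rparr>"
    by (rule is_functorI[OF map_cat_category[OF assms] assms(1)])
      (use assms(2,3) in \<open>auto simp: map_cat_def inj_eq\<close>)
qed

text \<open>Existence half of the universal property for any target whose carriers inject into the
  test types: move the functor into the copy of \<open>D\<close>, factor it there, and return along
  the inverse transport.\<close>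

lemma localization_lift:
  fixes D :: "('x, 'y) category" and i :: "'x \<Rightarrow> 't" and j :: "'y \<Rightarrow> 't \<times> 't"
  assumes loc: "is_localization TYPE('t) C W L P"
    and inj: "inj i" "inj j"
    and H: "is_functor C D H" "\<forall>w\<in>W. is_iso D (farr H w)"
  shows "\<exists>H'. is_functor L D H' \<and> functor_eq C (H' \<circ>\<^sub>F P) H"
proof -
  have D: "category D" using H(1) by (rule is_functor_category)
  let ?E = "map_cat i j D" and ?I = "\<lparr>fobj = i, farr = j\<rparr>" and ?J = "\<lparr>fobj = inv i, farr = inv j\<rparr>"
  note I = map_cat_functor[OF D inj]
  have "is_functor C ?E (?I \<circ>\<^sub>F H) \<and> (\<forall>w\<in>W. is_iso ?E (farr (?I \<circ>\<^sub>F H) w))"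
    using H functor_is_iso[OF I(1)] is_functor_comp[OF H(1) I(1)] by auto
  then obtain K where K: "is_functor L ?E K" "functor_eq C (K \<circ>\<^sub>F P) (?I \<circ>\<^sub>F H)"
    using loc unfolding is_localization_def by blast
  have "functor_eq C ((?J \<circ>\<^sub>F K) \<circ>\<^sub>F P) H"
    using K(2) inj by (auto simp: functor_eq_def)
  with is_functor_comp[OF K(1) I(2)] show ?thesis by blast
qed

text \<open>Uniqueness half for such targets: both functors, moved into the copy of
  \<open>D\<close>, factor the same functor on \<open>C\<close>, and injectivity of the transport
  strips the copy off again.\<close>

lemma localization_unique:
  fixes D :: "('x, 'y) category" and i :: "'x \<Rightarrow> 't" and j :: "'y \<Rightarrow> 't \<times> 't"
  assumes loc: "is_localization TYPE('t) C W L P"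
    and inj: "inj i" "inj j"
    and H: "is_functor L D H" "is_functor L D H'" "functor_eq C (H \<circ>\<^sub>F P) (H' \<circ>\<^sub>F P)"
  shows "functor_eq L H H'"
proof -
  have D: "category D" using H(1) by (rule is_functor_category)
  let ?E = "map_cat i j D" and ?I = "\<lparr>fobj = i, farr = j\<rparr>"
  note I = map_cat_functor[OF D inj]
  have P: "is_functor C L P" "\<forall>w\<in>W. is_iso L (farr P w)"
    using loc by (auto simp: is_localization_def)
  note HP = is_functor_comp[OF P(1) is_functor_comp[OF H(1) I(1)]]
  have "is_functor C ?E ((?I \<circ>\<^sub>F H) \<circ>\<^sub>F P) \<and> (\<forall>w\<in>W. is_iso ?E (farr ((?I \<circ>\<^sub>F H) \<circ>\<^sub>F P) w))"
    using HP P(2) functor_is_iso[OF is_functor_comp[OF H(1) I(1)]] by auto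
  then obtain K where K: "\<And>K'. is_functor L ?E K' \<Longrightarrow>
      functor_eq C (K' \<circ>\<^sub>F P) ((?I \<circ>\<^sub>F H) \<circ>\<^sub>F P) \<Longrightarrow> functor_eq L K' K"
    using loc unfolding is_localization_def by metis
  have "functor_eq L (?I \<circ>\<^sub>F H) K"
    using K[OF is_functor_comp[OF H(1) I(1)]] by (auto simp: functor_eq_def)
  moreover have "functor_eq L (?I \<circ>\<^sub>F H') K"
    using K[OF is_functor_comp[OF H(2) I(1)]] H(3) by (auto simp: functor_eq_def)
  ultimately show ?thesis by (simp add: functor_eq_def) (metis inj injD)
qed

inductive generated_arr :: "('o, 'a) category \<Rightarrow> ('u, 'v) category \<Rightarrow> ('o, 'a, 'u, 'v) fctor \<Rightarrow> 'v \<Rightarrow> bool"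
  for C L P where
  image: "f \<in> Arr C \<Longrightarrow> generated_arr C L P (farr P f)"
| comp: "u \<in> Arr L \<Longrightarrow> v \<in> Arr L \<Longrightarrow> Dom L v = Cod L u \<Longrightarrow> generated_arr C L P u \<Longrightarrow>
    generated_arr C L P v \<Longrightarrow> generated_arr C L P (v \<cdot>\<^bsub>L\<^esub> u)"
| inverse: "u \<in> Arr L \<Longrightarrow> v \<in> Arr L \<Longrightarrow> Dom L v = Cod L u \<Longrightarrow> Cod L v = Dom L u \<Longrightarrow>
    v \<cdot>\<^bsub>L\<^esub> u = Idt L (Dom L u) \<Longrightarrow> u \<cdot>\<^bsub>L\<^esub> v = Idt L (Cod L u) \<Longrightarrow>
    generated_arr C L P u \<Longrightarrow> generated_arr C L P v"

definition generates :: "('o, 'a) category \<Rightarrow> ('u, 'v) category \<Rightarrow> ('o, 'a, 'u, 'v) fctor \<Rightarrow> bool" where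
  "generates C L P \<longleftrightarrow> is_functor C L P \<and> bij_betw (fobj P) (Obj C) (Obj L) \<and>
    (\<forall>u \<in> Arr L. generated_arr C L P u)"

lemma localization_generates:
  fixes C :: "('o, 'a) category" and L :: "('u, 'v) category"
    and i :: "'u \<Rightarrow> 't" and j :: "'v \<Rightarrow> 't \<times> 't" and k :: "'o \<Rightarrow> 't"
  assumes loc: "is_localization TYPE('t) C W L P" and W: "W \<subseteq> Arr C"
    and inj: "inj i" "inj j" "inj k"
  shows "generates C L P"
proof -
  have P: "is_functor C L P" "\<forall>w\<in>W. is_iso L (farr P w)"
    using loc by (auto simp: is_localization_def)
  interpret C: category C using P(1) by (rule is_functor_category)
  interpret L: category L using P(1) by (rule is_functor_category)
  note Ps = functor_simps[OF P(1)]
  have inj_P: "inj_on (fobj P) (Obj C)"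
  proof -
    \<comment> \<open>the category on the objects of \<open>C\<close> with exactly one arrow between any two of them\<close>
    let ?D = "\<lparr>Obj = Obj C, Arr = Obj C \<times> Obj C, Dom = fst, Cod = snd, Idt = (\<lambda>X. (X, X)),
      Comp = (\<lambda>g f. (fst f, snd g))\<rparr>"
    let ?H = "\<lparr>fobj = id, farr = (\<lambda>f. (Dom C f, Cod C f))\<rparr>"
    have D: "category ?D" by (rule categoryI) auto
    have H: "is_functor C ?D ?H" by (rule is_functorI[OF C.category_axioms D]) auto
    have "\<forall>w\<in>W. is_iso ?D (farr ?H w)" using W by (auto simp: is_iso_def hom_def)
    \<comment> \<open>All arrows of \<open>?D\<close> are invertible, so \<open>?H\<close> inverts
      \<open>W\<close>, and its factorization through \<open>P\<close> recovers \<open>X\<close>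
      from \<open>fobj P X\<close>. Arrows of \<open>?D\<close> are pairs of objects, which is why
      the test types take arrows in a product.\<close>
    from localization_lift[OF loc inj(3) prod.inj_map[OF inj(3,3)] H this]
    obtain H' where "functor_eq C (H' \<circ>\<^sub>F P) ?H" by blast
    then have "fobj H' (fobj P X) = X" if "X \<in> Obj C" for X
      using that by (simp add: functor_eq_def)
    then show ?thesis by (metis inj_onI)
  qed
  \<comment> \<open>\<open>P\<close> factors through the subcategory of generated arrows; by uniqueness this splits the
    inclusion of the subcategory into \<open>L\<close>, which is therefore all of \<open>L\<close>.\<close>
  have "Obj L = fobj P ` Obj C \<and> (\<forall>u\<in>Arr L. generated_arr C L P u)"
  proof -
    let ?S = "generated_arr C L P"
    let ?A = "{f \<in> Arr L. ?S f \<and> Dom L f \<in> fobj P ` Obj C \<and> Cod L f \<in> fobj P ` Obj C}"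
    let ?D = "L\<lparr>Obj := fobj P ` Obj C, Arr := ?A\<rparr>"
    have S_Idt: "?S (Idt L (fobj P X))" if "X \<in> Obj C" for X
      using generated_arr.image[of "Idt C X" C L P] that by (simp add: Ps)
    have D: "category ?D"
      by (rule categoryI) (use S_Idt in \<open>auto simp: Ps generated_arr.comp L.Comp_assoc_Arr\<close>)
    have PD: "is_functor C ?D P"
      by (rule is_functorI[OF C.category_axioms D]) (auto simp: Ps generated_arr.image)
    have DL: "is_functor ?D L id_fctor"
      by (rule is_functorI[OF D L.category_axioms]) (auto simp: Ps)
    have "is_iso ?D (farr P w)" if "w \<in> W" for w
    proof -
      from that W have w: "w \<in> Arr C" by auto
      from P(2) that have "is_iso L (farr P w)" by blast
      then obtain g where g: "farr P w \<in> Arr L" "g \<in> Arr L" "Dom L g = Cod L (farr P w)"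
        "Cod L g = Dom L (farr P w)"
        "g \<cdot>\<^bsub>L\<^esub> farr P w = Idt L (Dom L (farr P w))" "farr P w \<cdot>\<^bsub>L\<^esub> g = Idt L (Cod L (farr P w))"
        by (rule L.is_isoE)
      \<comment> \<open>The inverse formed in \<open>L\<close> is itself generated, so
        \<open>farr P w\<close> is already invertible in the subcategory.\<close>
      then have "?S g" using generated_arr.image[OF w] by (rule generated_arr.inverse)
      with g generated_arr.image[OF w] w show ?thesis
        unfolding is_iso_def by (auto simp: hom_def Ps intro!: bexI[of _ g])
    qed
    with localization_lift[OF loc inj(1,2) PD] obtain H where
      H: "is_functor L ?D H" "functor_eq C (H \<circ>\<^sub>F P) P" by blast
    have "functor_eq L (id_fctor \<circ>\<^sub>F H) id_fctor"
      by (rule localization_unique[OF loc inj(1,2) is_functor_comp[OF H(1) DL]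
            is_functor_id[OF L.category_axioms]])
        (use H(2) in \<open>auto simp: functor_eq_def\<close>)
    then have HL: "\<And>X. X \<in> Obj L \<Longrightarrow> fobj H X = X" "\<And>f. f \<in> Arr L \<Longrightarrow> farr H f = f"
      by (auto simp: functor_eq_def)
    have "X \<in> fobj P ` Obj C" if "X \<in> Obj L" for X
      using functor_simps(1)[OF H(1) that] HL(1)[OF that] by simp
    moreover have "?S f" if "f \<in> Arr L" for f
      using functor_simps(2)[OF H(1) that] HL(2)[OF that] by simp
    ultimately show ?thesis by (auto simp: Ps)
  qed
  with P(1) inj_P show ?thesis by (simp add: generates_def bij_betw_def)
qed

text \<open>Bijectivity on objects lets \<open>\<gamma>\<close> define a component at each object of
  \<open>L\<close>. The arrows at which the naturality square commutes contain the images of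
  \<open>P\<close> and are closed under composition and inversion, hence are all arrows of
  \<open>L\<close>.\<close>

lemma generates_nat_trans_extend:
  assumes gen: "generates C L P" and S: "is_functor L D S" and T: "is_functor L D T"
    and \<gamma>: "\<And>X. X \<in> Obj C \<Longrightarrow> \<gamma> X \<in> hom D (fobj S (fobj P X)) (fobj T (fobj P X))"
    and nat: "\<And>f. f \<in> Arr C \<Longrightarrow>
      farr T (farr P f) \<cdot>\<^bsub>D\<^esub> \<gamma> (Dom C f) = \<gamma> (Cod C f) \<cdot>\<^bsub>D\<^esub> farr S (farr P f)"
  shows "\<exists>\<delta>. nat_trans L D S T \<delta> \<and> (\<forall>X \<in> Obj C. \<delta> (fobj P X) = \<gamma> X)"
proof -
  have P: "is_functor C L P" "inj_on (fobj P) (Obj C)" "Obj L = fobj P ` Obj C"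
    using gen by (auto simp: generates_def bij_betw_def)
  interpret C: category C using P(1) by (rule is_functor_category)
  interpret L: category L using P(1) by (rule is_functor_category)
  interpret D: category D using S by (rule is_functor_category)
  note Ps = functor_simps[OF P(1)] and Ss = functor_simps[OF S] and Ts = functor_simps[OF T]
  define \<delta> where "\<delta> U = \<gamma> (inv_into (Obj C) (fobj P) U)" for U
  have \<delta>P: "\<delta> (fobj P X) = \<gamma> X" if "X \<in> Obj C" for X
    using that P(2) by (simp add: \<delta>_def)
  have \<delta>: "\<delta> U \<in> Arr D \<and> Dom D (\<delta> U) = fobj S U \<and> Cod D (\<delta> U) = fobj T U" if "U \<in> Obj L" for U
    using that \<gamma> \<delta>P unfolding P(3) by (auto simp: hom_def)
  have "farr T u \<cdot>\<^bsub>D\<^esub> \<delta> (Dom L u) = \<delta> (Cod L u) \<cdot>\<^bsub>D\<^esub> farr S u" if "generated_arr C L P u" for u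
    using that
  proof induction
    case (image f)
    then show ?case using nat[of f] by (simp add: Ps \<delta>P)
  next
    case u: (comp u v)
    have "farr T (v \<cdot>\<^bsub>L\<^esub> u) \<cdot>\<^bsub>D\<^esub> \<delta> (Dom L (v \<cdot>\<^bsub>L\<^esub> u)) = farr T v \<cdot>\<^bsub>D\<^esub> (\<delta> (Dom L v) \<cdot>\<^bsub>D\<^esub> farr S u)"
      using u(1-3,6) by (simp add: Ts \<delta> D.Comp_assoc_Arr)
    also have "\<dots> = (farr T v \<cdot>\<^bsub>D\<^esub> \<delta> (Dom L v)) \<cdot>\<^bsub>D\<^esub> farr S u"
      using u(1-3) by (simp add: Ss Ts \<delta> D.Comp_assoc_Arr)
    also have "\<dots> = \<delta> (Cod L (v \<cdot>\<^bsub>L\<^esub> u)) \<cdot>\<^bsub>D\<^esub> farr S (v \<cdot>\<^bsub>L\<^esub> u)"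
      unfolding u(7) using u(1-3) by (simp add: Ss \<delta> D.Comp_assoc_Arr)
    finally show ?case .
  next
    case u: (inverse u v)
    have "\<delta> (Dom L u) \<cdot>\<^bsub>D\<^esub> farr S v = farr T v \<cdot>\<^bsub>D\<^esub> \<delta> (Cod L u)"
      by (rule D.inverse_square[where f = "farr S u" and f' = "farr T u"])
        (use u(1-4,8) in \<open>auto simp: hom_def Ss Ts \<delta> u(5,6) simp flip: Ss(6) Ts(6)\<close>)
    then show ?case using u(1-4) by simp
  qed
  with gen have "farr T u \<cdot>\<^bsub>D\<^esub> \<delta> (Dom L u) = \<delta> (Cod L u) \<cdot>\<^bsub>D\<^esub> farr S u" if "u \<in> Arr L" for u
    using that by (simp add: generates_def)
  with S T \<delta> have "nat_trans L D S T \<delta>" by (auto simp: nat_trans_def hom_def)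
  with \<delta>P show ?thesis by blast
qed


section \<open>Cofibrant replacement\<close>

text \<open>\<open>Q\<close> is a replacement with augmentation \<open>p\<close>, and \<open>S\<close> is induced by \<open>X \<mapsto> K (Q X)\<close>. The last
  condition on objects says that \<open>S\<close> does not distinguish \<open>Q (p X)\<close> from \<open>p (Q X)\<close>.\<close>

definition resolves ::
    "('o, 'a) category \<Rightarrow> ('u, 'v) category \<Rightarrow> ('o, 'a, 'u, 'v) fctor \<Rightarrow> ('x, 'y) category \<Rightarrow>
     ('o, 'a, 'x, 'y) fctor \<Rightarrow> ('u, 'v, 'x, 'y) fctor \<Rightarrow> ('o \<Rightarrow> 'o) \<Rightarrow> ('o \<Rightarrow> 'a) \<Rightarrow> bool" where
  "resolves C L P D K S Q p \<longleftrightarrow> is_functor C L P \<and> is_functor C D K \<and> is_functor L D S \<and>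
    (\<forall>X \<in> Obj C. p X \<in> hom C (Q X) X \<and> is_iso L (farr P (p X)) \<and>
      fobj S (fobj P X) = fobj K (Q X) \<and> farr S (farr P (p X)) = farr K (p (Q X))) \<and>
    (\<forall>f \<in> Arr C. \<exists>q \<in> hom C (Q (Dom C f)) (Q (Cod C f)).
      p (Cod C f) \<cdot>\<^bsub>C\<^esub> q = f \<cdot>\<^bsub>C\<^esub> p (Dom C f) \<and> farr S (farr P f) = farr K q)"

text \<open>\<open>B\<close> is the coproduct of two copies of \<open>A\<close> with coprojections
  \<open>i\<close> and \<open>j\<close>; a cylinder on \<open>A\<close> is obtained by factoring its
  fold map.\<close>

definition is_copower :: "('o, 'a) category \<Rightarrow> 'o \<Rightarrow> 'o \<Rightarrow> 'a \<Rightarrow> 'a \<Rightarrow> bool" where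
  "is_copower C A B i j \<longleftrightarrow> i \<in> hom C A B \<and> j \<in> hom C A B \<and>
    (\<forall>Y. \<forall>g \<in> hom C A Y. \<forall>h \<in> hom C A Y.
      \<exists>!k. k \<in> hom C B Y \<and> k \<cdot>\<^bsub>C\<^esub> i = g \<and> k \<cdot>\<^bsub>C\<^esub> j = h)"

definition discrete_cat :: "'j set \<Rightarrow> ('j, 'j) category" where
  "discrete_cat J = \<lparr>Obj = J, Arr = J, Dom = id, Cod = id, Idt = id, Comp = (\<lambda>g f. f)\<rparr>"

lemma discrete_cat_constant_functor:
  assumes "category C" "J = {} \<or> A \<in> Obj C"
  shows "is_functor (discrete_cat J) C \<lparr>fobj = (\<lambda>_. A), farr = (\<lambda>_. Idt C A)\<rparr>"
proof -
  interpret category C by fact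
  have J: "category (discrete_cat J)" by (rule categoryI) (auto simp: discrete_cat_def)
  show ?thesis
    by (rule is_functorI[OF J category_axioms]) (use assms(2) in \<open>auto simp: discrete_cat_def\<close>)
qed

section \<open>Cylinders, lifts and cofibrant replacement in a model category\<close>

context model_category
begin

lemma initial_exists: "\<exists>I. is_initial C I"
proof -
  \<comment> \<open>The initial object is the colimit of the empty diagram; as that diagram has no
    values, \<open>undefined\<close> may stand for them.\<close>
  let ?J = "discrete_cat ({} :: nat set)" and ?D = "\<lparr>fobj = (\<lambda>_. undefined), farr = (\<lambda>_. Idt C undefined)\<rparr>"
  obtain I \<iota> where I: "is_colimit ?J C ?D I \<iota>"
    using M0_colimits discrete_cat_constant_functor[OF category_axioms, of "{}" undefined]
    unfolding has_finite_colimits_def by (force simp: discrete_cat_def)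
  then have "is_initial C I"
    by (auto simp: is_colimit_def is_cocone_def is_initial_def discrete_cat_def)
  then show ?thesis ..
qed

lemma copower_exists:
  assumes "A \<in> Obj C"
  shows "\<exists>B i j. is_copower C A B i j"
proof -
  let ?J = "discrete_cat {0, 1 :: nat}" and ?D = "\<lparr>fobj = (\<lambda>_. A), farr = (\<lambda>_. Idt C A)\<rparr>"
  obtain B \<iota> where B: "is_colimit ?J C ?D B \<iota>"
    using M0_colimits discrete_cat_constant_functor[OF category_axioms, of "{0, 1}" A] assms
    unfolding has_finite_colimits_def by (force simp: discrete_cat_def)
  have "\<iota> 0 \<in> hom C A B" "\<iota> 1 \<in> hom C A B"
    using B by (auto simp: is_colimit_def is_cocone_def discrete_cat_def)
  moreover have "\<exists>!k. k \<in> hom C B Y \<and> k \<cdot>\<^bsub>C\<^esub> \<iota> 0 = g \<and> k \<cdot>\<^bsub>C\<^esub> \<iota> 1 = h"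
    if "g \<in> hom C A Y" "h \<in> hom C A Y" for Y g h
  proof -
    have "is_cocone ?J C ?D Y (\<lambda>n. if n = 0 then g else h)"
      using that by (auto simp: is_cocone_def discrete_cat_def hom_def)
    with B have "\<exists>!k. k \<in> hom C B Y \<and>
        (\<forall>n \<in> Obj ?J. k \<cdot>\<^bsub>C\<^esub> \<iota> n = (if n = 0 then g else h))"
      unfolding is_colimit_def by blast
    then show ?thesis by (simp add: discrete_cat_def)
  qed
  ultimately show ?thesis unfolding is_copower_def by blast
qed

lemma initial_eq:
  assumes "is_initial C I" "g \<in> hom C I X" "h \<in> hom C I X"
  shows "g = h"
proof -
  have "X \<in> Obj C" using assms(2) by (auto simp: hom_def)
  with assms show ?thesis unfolding is_initial_def by blast
qed

lemma cofibrant_Cof: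
  assumes "cofibrant C Cof X" "j \<in> Cof" "j \<in> hom C X Y"
  shows "cofibrant C Cof Y"
proof -
  from assms(1) obtain I f where f: "is_initial C I" "f \<in> hom C I X" "f \<in> Cof"
    by (auto simp: cofibrant_def)
  have "j \<cdot>\<^bsub>C\<^esub> f \<in> Cof" using M3_Cof_comp[OF f(3) assms(2)] f assms(3) by (auto simp: hom_def)
  moreover have "j \<cdot>\<^bsub>C\<^esub> f \<in> hom C I Y" using f assms(3) by (auto simp: hom_def)
  moreover have "Y \<in> Obj C" using assms(3) by (auto simp: hom_def)
  ultimately show ?thesis using f(1) unfolding cofibrant_def by blast
qed

text \<open>The copower is the pushout of the map from the initial object to \<open>A\<close> along
  itself, so \<open>i\<close> is a cobase change of a cofibration.\<close>

lemma cofibrant_coprojection: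
  assumes A: "cofibrant C Cof A" and B: "is_copower C A B i j"
  shows "i \<in> Cof"
proof -
  have i: "i \<in> hom C A B" "j \<in> hom C A B" and univ: "\<And>Y g h. g \<in> hom C A Y \<Longrightarrow> h \<in> hom C A Y \<Longrightarrow>
      \<exists>!k. k \<in> hom C B Y \<and> k \<cdot>\<^bsub>C\<^esub> i = g \<and> k \<cdot>\<^bsub>C\<^esub> j = h"
    using B by (auto simp: is_copower_def)
  from A obtain I f where I: "is_initial C I" and f: "f \<in> hom C I A" "f \<in> Cof"
    by (auto simp: cofibrant_def)
  have "pushout_square C f f i j"
    unfolding pushout_square_def
  proof (intro conjI allI impI)
    have "i \<cdot>\<^bsub>C\<^esub> f = j \<cdot>\<^bsub>C\<^esub> f"
      by (rule initial_eq[OF I, of _ B]) (use f i in \<open>auto simp: hom_def\<close>)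
    then show "commutative_square C f f i j"
      using f i by (auto simp: commutative_square_def hom_def)
  next
    fix r b assume "commutative_square C f f r b"
    then have "r \<in> hom C A (Cod C r)" "b \<in> hom C A (Cod C r)"
      using f by (auto simp: commutative_square_def hom_def)
    from univ[OF this] i(1)
    show "\<exists>!h. h \<in> hom C (Cod C i) (Cod C r) \<and> h \<cdot>\<^bsub>C\<^esub> i = r \<and> h \<cdot>\<^bsub>C\<^esub> j = b"
      by (simp add: hom_def)
  qed
  then show ?thesis using f(2) by (rule M3_Cof_cobase)
qed

text \<open>Two lifts of the same map through a trivial fibration are left homotopic: they glue to a
  map out of a cylinder \<open>Z\<close> on \<open>A\<close>. Since \<open>Z\<close> is again cofibrant, \<open>K\<close> inverts its projection
  to \<open>A\<close> and hence identifies the two ends.\<close>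

lemma lifts_identified:
  assumes K: "is_functor C D K"
    and KW: "\<And>w. w \<in> W \<Longrightarrow> cofibrant C Cof (Dom C w) \<Longrightarrow> cofibrant C Cof (Cod C w) \<Longrightarrow>
      is_iso D (farr K w)"
    and A: "cofibrant C Cof A" and gh: "g \<in> hom C A B" "h \<in> hom C A B"
    and p: "p \<in> Fib" "p \<in> W" "p \<in> hom C B Y" and eq: "p \<cdot>\<^bsub>C\<^esub> g = p \<cdot>\<^bsub>C\<^esub> h"
  shows "farr K g = farr K h"
proof -
  note Ks = functor_simps[OF K]
  interpret D: category D using K by (rule is_functor_category)
  have AO: "A \<in> Obj C" using A by (simp add: cofibrant_def)
  then obtain AA i j where copower: "is_copower C A AA i j" using copower_exists by blast
  then have ij: "i \<in> hom C A AA" "j \<in> hom C A AA" and univ: "\<And>Y g h. g \<in> hom C A Y \<Longrightarrow>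
      h \<in> hom C A Y \<Longrightarrow> \<exists>!k. k \<in> hom C AA Y \<and> k \<cdot>\<^bsub>C\<^esub> i = g \<and> k \<cdot>\<^bsub>C\<^esub> j = h"
    by (auto simp: is_copower_def)
  have univ_eq: "k = l" if "k \<in> hom C AA Y" "l \<in> hom C AA Y" "k \<cdot>\<^bsub>C\<^esub> i = l \<cdot>\<^bsub>C\<^esub> i" "k \<cdot>\<^bsub>C\<^esub> j = l \<cdot>\<^bsub>C\<^esub> j"
    for k l Y
    using univ[of "l \<cdot>\<^bsub>C\<^esub> i" Y "l \<cdot>\<^bsub>C\<^esub> j"] that ij by (auto simp: hom_def)
  have AA: "cofibrant C Cof AA"
    using cofibrant_Cof[OF A cofibrant_coprojection[OF A copower] ij(1)] .
  \<comment> \<open>The fold map. Its factorization below into a cofibration \<open>c\<close> and a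
    trivial fibration \<open>s\<close> gives the cylinder \<open>Z\<close>, with ends
    \<open>c\<close> after \<open>i\<close> and \<open>c\<close> after \<open>j\<close>.\<close>
  obtain n where n: "n \<in> hom C AA A" "n \<cdot>\<^bsub>C\<^esub> i = Idt C A" "n \<cdot>\<^bsub>C\<^esub> j = Idt C A"
    using univ[OF Idt_in_hom[OF AO] Idt_in_hom[OF AO]] by blast
  from n(1) have "n \<in> Arr C" by (simp add: hom_def)
  then obtain c s where cs: "c \<in> Cof" "s \<in> Fib \<inter> W" "Cod C c = Dom C s" "n = s \<cdot>\<^bsub>C\<^esub> c"
    using M2_trivial_fib by blast
  define Z where "Z = Dom C s"
  have "c \<in> Arr C" "s \<in> Arr C" using cs Cof_Arr W_Arr by auto
  then have c: "c \<in> hom C AA Z" and s: "s \<in> hom C Z A"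
    using n(1) cs(3,4) by (auto simp: hom_def Z_def)
  have Z: "cofibrant C Cof Z" using cofibrant_Cof[OF AA cs(1) c] .
  have sA: "s \<cdot>\<^bsub>C\<^esub> (c \<cdot>\<^bsub>C\<^esub> i) = Idt C A" "s \<cdot>\<^bsub>C\<^esub> (c \<cdot>\<^bsub>C\<^esub> j) = Idt C A"
    using n(2,3) c s ij by (auto simp: cs(4) hom_def Comp_assoc_Arr)
  have "is_iso D (farr K s)" using KW[of s] cs(2) Z A s by (auto simp: hom_def)
  then have ends: "farr K (c \<cdot>\<^bsub>C\<^esub> i) = farr K (c \<cdot>\<^bsub>C\<^esub> j)"
  proof (rule D.iso_cancel_left)
    show "farr K s \<cdot>\<^bsub>D\<^esub> farr K (c \<cdot>\<^bsub>C\<^esub> i) = farr K s \<cdot>\<^bsub>D\<^esub> farr K (c \<cdot>\<^bsub>C\<^esub> j)"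
      using c s ij sA by (simp add: hom_def flip: Ks(6))
  qed (use c s ij in \<open>auto simp: hom_def Ks\<close>)
  obtain k where k: "k \<in> hom C AA B" "k \<cdot>\<^bsub>C\<^esub> i = g" "k \<cdot>\<^bsub>C\<^esub> j = h"
    using univ[OF gh] by blast
  \<comment> \<open>Since \<open>p\<close> equalizes \<open>g\<close> and \<open>h\<close>, the map
    \<open>k\<close> glued from them becomes, after \<open>p\<close>, a map through the fold map,
    hence through the cylinder. This gives the lifting problem of \<open>c\<close> against
    \<open>p\<close>.\<close>
  have "p \<cdot>\<^bsub>C\<^esub> k = (p \<cdot>\<^bsub>C\<^esub> g) \<cdot>\<^bsub>C\<^esub> n"
  proof (rule univ_eq)
    show "(p \<cdot>\<^bsub>C\<^esub> k) \<cdot>\<^bsub>C\<^esub> i = ((p \<cdot>\<^bsub>C\<^esub> g) \<cdot>\<^bsub>C\<^esub> n) \<cdot>\<^bsub>C\<^esub> i"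
      using p k n gh ij by (auto simp: hom_def Comp_assoc_Arr)
    show "(p \<cdot>\<^bsub>C\<^esub> k) \<cdot>\<^bsub>C\<^esub> j = ((p \<cdot>\<^bsub>C\<^esub> g) \<cdot>\<^bsub>C\<^esub> n) \<cdot>\<^bsub>C\<^esub> j"
      unfolding eq using p k n gh ij by (auto simp: hom_def Comp_assoc_Arr)
  qed (use p k n gh in \<open>auto simp: hom_def\<close>)
  then have "commutative_square C k c p ((p \<cdot>\<^bsub>C\<^esub> g) \<cdot>\<^bsub>C\<^esub> s)"
    using p k c s gh by (auto simp: commutative_square_def hom_def cs(4) Comp_assoc_Arr)
  \<comment> \<open>\<open>H\<close> is the left homotopy: its restrictions to the two ends of
    \<open>Z\<close> are \<open>g\<close> and \<open>h\<close>.\<close>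
  from M1[OF cs(1) p(1) _ this] p(2) obtain H where H: "H \<in> hom C Z B" "H \<cdot>\<^bsub>C\<^esub> c = k"
    using c p(3) by (auto simp: hom_def)
  have "g = H \<cdot>\<^bsub>C\<^esub> (c \<cdot>\<^bsub>C\<^esub> i)" "h = H \<cdot>\<^bsub>C\<^esub> (c \<cdot>\<^bsub>C\<^esub> j)"
    using H c ij k by (auto simp: hom_def simp flip: Comp_assoc_Arr)
  then show ?thesis using ends H(1) c ij by (simp add: hom_def Ks)
qed

lemma cofibrant_replacement:
  assumes "X \<in> Obj C"
  shows "\<exists>Q p. cofibrant C Cof Q \<and> p \<in> hom C Q X \<and> p \<in> Fib \<and> p \<in> W"
proof -
  obtain I where I: "is_initial C I" using initial_exists ..
  with assms obtain f where f: "f \<in> hom C I X" unfolding is_initial_def by blast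
  then have "f \<in> Arr C" by (simp add: hom_def)
  then obtain i p where ip: "i \<in> Cof" "p \<in> Fib \<inter> W" "Cod C i = Dom C p" "f = p \<cdot>\<^bsub>C\<^esub> i"
    using M2_trivial_fib by blast
  then have "i \<in> Arr C" "p \<in> Arr C" using Cof_Arr W_Arr by auto
  then have "i \<in> hom C I (Dom C p)" "p \<in> hom C (Dom C p) X" "Dom C p \<in> Obj C"
    using f ip(3,4) by (auto simp: hom_def)
  with ip(1,2) I show ?thesis unfolding cofibrant_def by blast
qed

text \<open>A lifting problem with the initial object in the upper left corner; the square commutes
  because maps out of that object are unique.\<close>

lemma lift_exists:
  assumes "cofibrant C Cof A" "p \<in> Fib" "p \<in> W" "p \<in> hom C B Y" "f \<in> hom C A Y"
  shows "\<exists>g \<in> hom C A B. p \<cdot>\<^bsub>C\<^esub> g = f"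
proof -
  from assms(1) obtain I i where I: "is_initial C I" and i: "i \<in> hom C I A" "i \<in> Cof"
    by (auto simp: cofibrant_def)
  have "B \<in> Obj C" using assms(4) by (auto simp: hom_def)
  with I obtain u where u: "u \<in> hom C I B" unfolding is_initial_def by blast
  have "p \<cdot>\<^bsub>C\<^esub> u = f \<cdot>\<^bsub>C\<^esub> i"
    by (rule initial_eq[OF I, of _ Y]) (use u i assms in \<open>auto simp: hom_def\<close>)
  then have "commutative_square C u i p f"
    using u i assms by (auto simp: commutative_square_def hom_def)
  from M1[OF i(2) assms(2) _ this] assms(3,4) i show ?thesis by (auto simp: hom_def)
qed

text \<open>The factorization property enters as the assumption \<open>lift\<close>, so the
  statement involves no test type and can be instantiated both for \<open>F\<close> and, in the
  opposite categories, for \<open>G\<close>. There \<open>KW\<close> becomes the hypothesis on weak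
  equivalences between cofibrant, respectively fibrant, objects.\<close>

theorem resolution_exists:
  assumes K: "is_functor C D K"
    and KW: "\<And>w. w \<in> W \<Longrightarrow> cofibrant C Cof (Dom C w) \<Longrightarrow> cofibrant C Cof (Cod C w) \<Longrightarrow>
      is_iso D (farr K w)"
    and P: "is_functor C L P" "\<And>w. w \<in> W \<Longrightarrow> is_iso L (farr P w)"
    and lift: "\<And>H. is_functor C D H \<Longrightarrow> (\<forall>w\<in>W. is_iso D (farr H w)) \<Longrightarrow>
      \<exists>S. is_functor L D S \<and> functor_eq C (S \<circ>\<^sub>F P) H"
  shows "\<exists>S Q p. resolves C L P D K S Q p"
proof -
  note Ks = functor_simps[OF K]
  interpret D: category D using K by (rule is_functor_category)
  have "\<forall>X\<in>Obj C. \<exists>Qp. cofibrant C Cof (fst Qp) \<and> snd Qp \<in> hom C (fst Qp) X \<and>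
      snd Qp \<in> Fib \<and> snd Qp \<in> W"
    using cofibrant_replacement by simp
  from bchoice[OF this] obtain Qp where Qp: "\<And>X. X \<in> Obj C \<Longrightarrow> cofibrant C Cof (fst (Qp X)) \<and>
      snd (Qp X) \<in> hom C (fst (Qp X)) X \<and> snd (Qp X) \<in> Fib \<and> snd (Qp X) \<in> W"
    by blast
  define Q where "Q X = fst (Qp X)" for X
  define p where "p X = snd (Qp X)" for X
  have Q: "cofibrant C Cof (Q X)" "p X \<in> Fib" "p X \<in> W" "p X \<in> Arr C" "Dom C (p X) = Q X"
    "Cod C (p X) = X" "Q X \<in> Obj C" "p X \<in> hom C (Q X) X" if "X \<in> Obj C" for X
    using Qp[OF that] by (auto simp: Q_def p_def hom_def cofibrant_def)
  have "\<exists>q. q \<in> hom C (Q (Dom C f)) (Q (Cod C f)) \<and>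
      p (Cod C f) \<cdot>\<^bsub>C\<^esub> q = f \<cdot>\<^bsub>C\<^esub> p (Dom C f)" if "f \<in> Arr C" for f
    using lift_exists[of "Q (Dom C f)" "p (Cod C f)" "Q (Cod C f)" "Cod C f" "f \<cdot>\<^bsub>C\<^esub> p (Dom C f)"]
      that Q by (auto simp: hom_def)
  then obtain q where q: "\<And>f. f \<in> Arr C \<Longrightarrow> q f \<in> hom C (Q (Dom C f)) (Q (Cod C f))"
    "\<And>f. f \<in> Arr C \<Longrightarrow> p (Cod C f) \<cdot>\<^bsub>C\<^esub> q f = f \<cdot>\<^bsub>C\<^esub> p (Dom C f)"
    by metis
  have qs: "q f \<in> Arr C" "Dom C (q f) = Q (Dom C f)" "Cod C (q f) = Q (Cod C f)"
    if "f \<in> Arr C" for f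
    using q(1)[OF that] by (auto simp: hom_def)
  \<comment> \<open>Any lift may replace the chosen one under \<open>K\<close>. Functoriality of
    \<open>?H\<close> follows since identities lift identities and composites of lifts lift
    composites.\<close>
  have Kq: "farr K g = farr K (q f)"
    if "f \<in> Arr C" "g \<in> hom C (Q (Dom C f)) (Q (Cod C f))"
      "p (Cod C f) \<cdot>\<^bsub>C\<^esub> g = f \<cdot>\<^bsub>C\<^esub> p (Dom C f)" for f g
    by (rule lifts_identified[OF K KW, where p = "p (Cod C f)"])
      (use that q Q in \<open>auto simp: hom_def\<close>)
  let ?H = "\<lparr>fobj = (\<lambda>X. fobj K (Q X)), farr = (\<lambda>f. farr K (q f))\<rparr>"
  have H: "is_functor C D ?H"
  proof (rule is_functorI[OF category_axioms D.category_axioms], goal_cases)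
    case (5 X)
    then show ?case using Kq[of "Idt C X" "Idt C (Q X)"] Q by (simp add: Ks hom_def)
  next
    case (6 f g)
    have "p (Cod C g) \<cdot>\<^bsub>C\<^esub> (q g \<cdot>\<^bsub>C\<^esub> q f) = (p (Cod C g) \<cdot>\<^bsub>C\<^esub> q g) \<cdot>\<^bsub>C\<^esub> q f"
      using 6 qs Q by (simp add: Comp_assoc_Arr)
    also have "\<dots> = g \<cdot>\<^bsub>C\<^esub> (p (Cod C f) \<cdot>\<^bsub>C\<^esub> q f)"
      using 6 qs Q by (simp add: q(2) Comp_assoc_Arr)
    also have "\<dots> = (g \<cdot>\<^bsub>C\<^esub> f) \<cdot>\<^bsub>C\<^esub> p (Dom C f)"
      using 6 Q by (simp add: q(2) Comp_assoc_Arr)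
    finally show ?case
      using Kq[of "g \<cdot>\<^bsub>C\<^esub> f" "q g \<cdot>\<^bsub>C\<^esub> q f"] 6 qs by (simp add: Ks hom_def)
  qed (use qs Q in \<open>auto simp: Ks\<close>)
  have "is_iso D (farr ?H w)" if "w \<in> W" for w
  proof -
    have w: "w \<in> Arr C" using that W_Arr by auto
    \<comment> \<open>Two out of three in the square formed by \<open>w\<close>, \<open>q w\<close>
      and the augmentations, which are weak equivalences.\<close>
    have "w \<cdot>\<^bsub>C\<^esub> p (Dom C w) \<in> W" using M5_comp[of "p (Dom C w)" w] w that Q by simp
    then have "q w \<in> W" using M5_right[of "q w" "p (Cod C w)"] q(2)[OF w] w qs Q by simp
    then show ?thesis using KW[of "q w"] w qs Q by simp
  qed
  with lift[OF H] obtain S where S: "is_functor L D S" "functor_eq C (S \<circ>\<^sub>F P) ?H" by blast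
  then have SP: "\<And>X. X \<in> Obj C \<Longrightarrow> fobj S (fobj P X) = fobj K (Q X)"
    "\<And>f. f \<in> Arr C \<Longrightarrow> farr S (farr P f) = farr K (q f)"
    by (auto simp: functor_eq_def)
  \<comment> \<open>\<open>p (Q X)\<close> satisfies tautologically the equation that characterizes
    lifts of \<open>p X\<close>.\<close>
  have "farr S (farr P (p X)) = farr K (p (Q X))" if "X \<in> Obj C" for X
    using Kq[of "p X" "p (Q X)"] that Q by (simp add: SP)
  then have "resolves C L P D K S Q p"
    unfolding resolves_def using K P S(1) SP Q q by (intro conjI ballI bexI[of _ "q _"]) auto
  then show ?thesis by blast
qed

end


section \<open>Derived functors and the derived adjunction\<close>

lemma resolvesD:
  assumes "resolves C L P D K S Q p"
  shows "is_functor C L P" "is_functor C D K" "is_functor L D S"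
    "X \<in> Obj C \<Longrightarrow> p X \<in> Arr C" "X \<in> Obj C \<Longrightarrow> Dom C (p X) = Q X" "X \<in> Obj C \<Longrightarrow> Cod C (p X) = X"
    "X \<in> Obj C \<Longrightarrow> Q X \<in> Obj C"
    "X \<in> Obj C \<Longrightarrow> is_iso L (farr P (p X))"
    "X \<in> Obj C \<Longrightarrow> fobj S (fobj P X) = fobj K (Q X)"
    "X \<in> Obj C \<Longrightarrow> farr S (farr P (p X)) = farr K (p (Q X))"
proof -
  have C: "category C" using assms by (auto simp: resolves_def is_functor_def)
  show "X \<in> Obj C \<Longrightarrow> Q X \<in> Obj C"
    using assms category.Dom_in_Obj[OF C, of "p X"] by (auto simp: resolves_def hom_def)
qed (use assms in \<open>auto simp: resolves_def hom_def\<close>)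

lemma resolves_lift:
  assumes "resolves C L P D K S Q p" "f \<in> Arr C"
  obtains q where "q \<in> Arr C" "Dom C q = Q (Dom C f)" "Cod C q = Q (Cod C f)"
    "p (Cod C f) \<cdot>\<^bsub>C\<^esub> q = f \<cdot>\<^bsub>C\<^esub> p (Dom C f)" "farr S (farr P f) = farr K q"
  using assms by (auto simp: resolves_def hom_def)

definition inv_arr :: "('o, 'a) category \<Rightarrow> 'a \<Rightarrow> 'a" where
  "inv_arr C f = (SOME g. g \<in> hom C (Cod C f) (Dom C f) \<and>
    g \<cdot>\<^bsub>C\<^esub> f = Idt C (Dom C f) \<and> f \<cdot>\<^bsub>C\<^esub> g = Idt C (Cod C f))"

lemma inv_arr:
  assumes "is_iso C f"
  shows "inv_arr C f \<in> Arr C" "Dom C (inv_arr C f) = Cod C f" "Cod C (inv_arr C f) = Dom C f"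
    "inv_arr C f \<cdot>\<^bsub>C\<^esub> f = Idt C (Dom C f)" "f \<cdot>\<^bsub>C\<^esub> inv_arr C f = Idt C (Cod C f)"
proof -
  have "\<exists>g. g \<in> hom C (Cod C f) (Dom C f) \<and>
      g \<cdot>\<^bsub>C\<^esub> f = Idt C (Dom C f) \<and> f \<cdot>\<^bsub>C\<^esub> g = Idt C (Cod C f)"
    using assms by (auto simp: is_iso_def)
  from someI_ex[OF this, folded inv_arr_def]
  show "inv_arr C f \<in> Arr C" "Dom C (inv_arr C f) = Cod C f" "Cod C (inv_arr C f) = Dom C f"
    "inv_arr C f \<cdot>\<^bsub>C\<^esub> f = Idt C (Dom C f)" "f \<cdot>\<^bsub>C\<^esub> inv_arr C f = Idt C (Cod C f)"
    by (auto simp: hom_def)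
qed

text \<open>The inverted augmentation is the arrow from \<open>P X\<close> back to
  \<open>P (Q X)\<close> that exists only in \<open>L\<close>. The last clause is its naturality
  along any lift \<open>q\<close> of \<open>f\<close>, obtained by inverting the square that relates
  \<open>q\<close> to \<open>f\<close>.\<close>

lemma resolves_inverse:
  assumes "resolves C L P D K S Q p"
  shows "X \<in> Obj C \<Longrightarrow> inv_arr L (farr P (p X)) \<in> Arr L"
    "X \<in> Obj C \<Longrightarrow> Dom L (inv_arr L (farr P (p X))) = fobj P X"
    "X \<in> Obj C \<Longrightarrow> Cod L (inv_arr L (farr P (p X))) = fobj P (Q X)"
    "X \<in> Obj C \<Longrightarrow> inv_arr L (farr P (p X)) \<cdot>\<^bsub>L\<^esub> farr P (p X) = Idt L (fobj P (Q X))"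
    "X \<in> Obj C \<Longrightarrow> farr P (p X) \<cdot>\<^bsub>L\<^esub> inv_arr L (farr P (p X)) = Idt L (fobj P X)"
    "f \<in> Arr C \<Longrightarrow> q \<in> Arr C \<Longrightarrow> Dom C q = Q (Dom C f) \<Longrightarrow> Cod C q = Q (Cod C f) \<Longrightarrow>
      p (Cod C f) \<cdot>\<^bsub>C\<^esub> q = f \<cdot>\<^bsub>C\<^esub> p (Dom C f) \<Longrightarrow>
      farr P q \<cdot>\<^bsub>L\<^esub> inv_arr L (farr P (p (Dom C f))) =
        inv_arr L (farr P (p (Cod C f))) \<cdot>\<^bsub>L\<^esub> farr P f"
proof -
  note res = resolvesD[OF assms] and Ps = functor_simps[OF resolvesD(1)[OF assms]]
  interpret C: category C using res(1) by (rule is_functor_category)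
  interpret L: category L using res(1) by (rule is_functor_category)
  show r: "inv_arr L (farr P (p X)) \<in> Arr L" "Dom L (inv_arr L (farr P (p X))) = fobj P X"
    "Cod L (inv_arr L (farr P (p X))) = fobj P (Q X)"
    "inv_arr L (farr P (p X)) \<cdot>\<^bsub>L\<^esub> farr P (p X) = Idt L (fobj P (Q X))"
    "farr P (p X) \<cdot>\<^bsub>L\<^esub> inv_arr L (farr P (p X)) = Idt L (fobj P X)" if "X \<in> Obj C" for X
    using that inv_arr[OF res(8)[OF that]] by (simp_all add: Ps res(4-6))
  assume q: "f \<in> Arr C" "q \<in> Arr C" "Dom C q = Q (Dom C f)" "Cod C q = Q (Cod C f)"
    "p (Cod C f) \<cdot>\<^bsub>C\<^esub> q = f \<cdot>\<^bsub>C\<^esub> p (Dom C f)"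
  show "farr P q \<cdot>\<^bsub>L\<^esub> inv_arr L (farr P (p (Dom C f))) =
      inv_arr L (farr P (p (Cod C f))) \<cdot>\<^bsub>L\<^esub> farr P f"
  proof (rule L.inverse_square[where f = "farr P (p (Dom C f))" and f' = "farr P (p (Cod C f))"])
    show "farr P (p (Cod C f)) \<cdot>\<^bsub>L\<^esub> farr P q = farr P f \<cdot>\<^bsub>L\<^esub> farr P (p (Dom C f))"
      using q(1-4) by (simp add: q(5) res flip: Ps(6))
  qed (use q(1-4) r in \<open>auto simp: hom_def res Ps\<close>)
qed

text \<open>The component of \<open>\<delta>\<close> at \<open>P X\<close> is forced: naturality
  along the invertible \<open>P (p X)\<close> moves it to \<open>P (Q X)\<close>, and there the
  required factorization of \<open>\<gamma>\<close> determines it.\<close>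

theorem resolves_total_left_derived:
  assumes gen: "generates C L P" and res: "resolves C L P L' (P' \<circ>\<^sub>F F) S Q p"
  shows "is_total_left_derived C L P C' L' P' F S (\<lambda>X. farr (P' \<circ>\<^sub>F F) (p X))"
proof -
  define K where "K = P' \<circ>\<^sub>F F"
  note res = res[folded K_def]
  note rs = resolvesD[OF res]
  note Ps = functor_simps[OF rs(1)] and Ks = functor_simps[OF rs(2)] and Ss = functor_simps[OF rs(3)]
  interpret C: category C using rs(1) by (rule is_functor_category)
  interpret L: category L using rs(1) by (rule is_functor_category)
  interpret D: category L' using rs(3) by (rule is_functor_category)
  define r where "r X = inv_arr L (farr P (p X))" for X
  note r = resolves_inverse[OF res, folded r_def]
  have SP: "is_functor C L' (S \<circ>\<^sub>F P)" using is_functor_comp[OF rs(1,3)] .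
  have "farr K f \<cdot>\<^bsub>L'\<^esub> farr K (p (Dom C f)) = farr K (p (Cod C f)) \<cdot>\<^bsub>L'\<^esub> farr S (farr P f)"
    if f: "f \<in> Arr C" for f
  proof -
    obtain q where q: "q \<in> Arr C" "Dom C q = Q (Dom C f)" "Cod C q = Q (Cod C f)"
      "p (Cod C f) \<cdot>\<^bsub>C\<^esub> q = f \<cdot>\<^bsub>C\<^esub> p (Dom C f)" "farr S (farr P f) = farr K q"
      using res f by (rule resolves_lift)
    then show ?thesis using f by (simp add: rs flip: Ks(6))
  qed
  then have \<alpha>: "nat_trans C L' (S \<circ>\<^sub>F P) K (\<lambda>X. farr K (p X))"
    using SP rs by (auto simp: nat_trans_def hom_def Ks)
  have "\<exists>\<delta>. nat_trans L L' T S \<delta> \<and>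
        (\<forall>X \<in> Obj C. \<gamma> X = farr K (p X) \<cdot>\<^bsub>L'\<^esub> \<delta> (fobj P X)) \<and>
        (\<forall>\<delta>'. nat_trans L L' T S \<delta>' \<and>
          (\<forall>X \<in> Obj C. \<gamma> X = farr K (p X) \<cdot>\<^bsub>L'\<^esub> \<delta>' (fobj P X)) \<longrightarrow>
          (\<forall>X \<in> Obj L. \<delta>' X = \<delta> X))"
    if T: "is_functor L L' T" and \<gamma>: "nat_trans C L' (T \<circ>\<^sub>F P) K \<gamma>" for T \<gamma>
  proof -
    note Ts = functor_simps[OF T] and \<gamma>s = nat_trans_simps[OF \<gamma>, simplified]
    \<comment> \<open>The only possible value: go back along \<open>T (r X)\<close>, with
      \<open>r X\<close> the inverse of \<open>P (p X)\<close>, and apply \<open>\<gamma>\<close> at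
      the replacement.\<close>
    define \<delta>0 where "\<delta>0 X = \<gamma> (Q X) \<cdot>\<^bsub>L'\<^esub> farr T (r X)" for X
    have "\<exists>\<delta>. nat_trans L L' T S \<delta> \<and> (\<forall>X \<in> Obj C. \<delta> (fobj P X) = \<delta>0 X)"
    proof (rule generates_nat_trans_extend[OF gen T rs(3)])
      show "\<delta>0 X \<in> hom L' (fobj T (fobj P X)) (fobj S (fobj P X))" if "X \<in> Obj C" for X
        using that r(1-3) by (simp add: \<delta>0_def hom_def \<gamma>s Ts rs)
      fix f assume f: "f \<in> Arr C"
      obtain q where q: "q \<in> Arr C" "Dom C q = Q (Dom C f)" "Cod C q = Q (Cod C f)"
        "p (Cod C f) \<cdot>\<^bsub>C\<^esub> q = f \<cdot>\<^bsub>C\<^esub> p (Dom C f)" "farr S (farr P f) = farr K q"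
        using res f by (rule resolves_lift)
      note fr = f q(1-3) r(1-3) \<gamma>s(1-3) Ts(2-4) Ps(2-4) Ks(2-4) rs(7) D.Comp_assoc_Arr
      have "farr K q \<cdot>\<^bsub>L'\<^esub> \<delta>0 (Dom C f) = (farr K q \<cdot>\<^bsub>L'\<^esub> \<gamma> (Dom C q)) \<cdot>\<^bsub>L'\<^esub> farr T (r (Dom C f))"
        by (simp add: \<delta>0_def fr)
      also have "\<dots> = \<gamma> (Cod C q) \<cdot>\<^bsub>L'\<^esub> (farr T (farr P q) \<cdot>\<^bsub>L'\<^esub> farr T (r (Dom C f)))"
        unfolding \<gamma>s(4)[OF q(1)] by (simp add: fr)
      also have "farr T (farr P q) \<cdot>\<^bsub>L'\<^esub> farr T (r (Dom C f)) =
          farr T (r (Cod C f)) \<cdot>\<^bsub>L'\<^esub> farr T (farr P f)"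
        using r(6)[OF f q(1-4)] by (simp add: fr flip: Ts(6))
      finally show "farr S (farr P f) \<cdot>\<^bsub>L'\<^esub> \<delta>0 (Dom C f) = \<delta>0 (Cod C f) \<cdot>\<^bsub>L'\<^esub> farr T (farr P f)"
        by (simp add: \<delta>0_def q(5) fr)
    qed
    then obtain \<delta> where \<delta>: "nat_trans L L' T S \<delta>" "\<And>X. X \<in> Obj C \<Longrightarrow> \<delta> (fobj P X) = \<delta>0 X" by blast
    have "\<gamma> X = farr K (p X) \<cdot>\<^bsub>L'\<^esub> \<delta> (fobj P X)" if X: "X \<in> Obj C" for X
    proof -
      note Xr = X r(1-3) \<gamma>s(1-3) Ts(1-4) Ps(1-4) Ks(2-4) rs(4-7) D.Comp_assoc_Arr
      have "farr K (p X) \<cdot>\<^bsub>L'\<^esub> \<delta> (fobj P X) = (farr K (p X) \<cdot>\<^bsub>L'\<^esub> \<gamma> (Dom C (p X))) \<cdot>\<^bsub>L'\<^esub> farr T (r X)"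
        by (simp add: \<delta>(2) \<delta>0_def Xr)
      \<comment> \<open>Naturality of \<open>\<gamma>\<close> at \<open>p X\<close> brings
        \<open>T (P (p X))\<close> next to \<open>T (r X)\<close>, where they cancel.\<close>
      also have "\<dots> = \<gamma> X \<cdot>\<^bsub>L'\<^esub> (farr T (farr P (p X)) \<cdot>\<^bsub>L'\<^esub> farr T (r X))"
        unfolding \<gamma>s(4)[OF rs(4)[OF X]] by (simp add: Xr)
      also have "\<dots> = \<gamma> X" by (simp add: Xr r(5) Ts(5) flip: Ts(6))
      finally show ?thesis ..
    qed
    moreover have "\<delta>' U = \<delta> U"
      if \<delta>': "nat_trans L L' T S \<delta>'" "\<And>X. X \<in> Obj C \<Longrightarrow> \<gamma> X = farr K (p X) \<cdot>\<^bsub>L'\<^esub> \<delta>' (fobj P X)"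
        and U: "U \<in> Obj L" for \<delta>' U
    proof -
      obtain X where X: "X \<in> Obj C" "U = fobj P X"
        using gen U by (auto simp: generates_def bij_betw_def)
      note ds = nat_trans_simps[OF \<delta>'(1)]
      note Xr = X(1) r(1-3) ds(1-3) Ts(1-4) Ps(1-4) Ss(1-4) rs(4-7)
      have "\<delta>' (fobj P X) = \<delta>' (fobj P X) \<cdot>\<^bsub>L'\<^esub> farr T (farr P (p X) \<cdot>\<^bsub>L\<^esub> r X)"
        by (simp add: Xr r(5) Ts(5))
      also have "\<dots> = (\<delta>' (Cod L (farr P (p X))) \<cdot>\<^bsub>L'\<^esub> farr T (farr P (p X))) \<cdot>\<^bsub>L'\<^esub> farr T (r X)"
        by (simp add: Xr Ts(6) D.Comp_assoc_Arr)
      \<comment> \<open>Naturality of \<open>\<delta>'\<close> produces \<open>S (P (p X))\<close>.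
        Its identification with \<open>K (p (Q X))\<close> is what makes the hypothesis on
        \<open>\<delta>'\<close>, taken at \<open>Q X\<close> instead of \<open>X\<close>,
        applicable.\<close>
      also have "\<dots> = (farr K (p (Q X)) \<cdot>\<^bsub>L'\<^esub> \<delta>' (fobj P (Q X))) \<cdot>\<^bsub>L'\<^esub> farr T (r X)"
        using ds(4)[of "farr P (p X)"] by (simp add: Xr rs(10))
      also have "\<dots> = \<delta> (fobj P X)" using \<delta>'(2)[of "Q X"] by (simp add: \<delta>(2) \<delta>0_def Xr)
      finally show ?thesis unfolding X(2) .
    qed
    ultimately show ?thesis using \<delta>(1) by blast
  qed
  with \<alpha> rs(3) show ?thesis unfolding is_total_left_derived_def K_def by blast
qed

section \<open>The derived unit and the triangle identity\<close>

text \<open>Written without inverting \<open>P (p X)\<close>, so that the same condition in the opposite categories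
  describes the derived counit.\<close>

definition derived_unit_at ::
    "('o, 'a) category \<Rightarrow> ('u, 'v) category \<Rightarrow> ('o, 'a, 'u, 'v) fctor \<Rightarrow> ('o, 'a, 'o', 'a') fctor \<Rightarrow>
     ('o', 'a', 'o, 'a) fctor \<Rightarrow> ('o \<Rightarrow> 'a) \<Rightarrow> ('o \<Rightarrow> 'o) \<Rightarrow> ('o \<Rightarrow> 'a) \<Rightarrow> ('o' \<Rightarrow> 'a') \<Rightarrow>
     ('u \<Rightarrow> 'v) \<Rightarrow> 'o \<Rightarrow> bool" where
  "derived_unit_at C L P F G \<eta> Q p r H X \<longleftrightarrow>
    H (fobj P X) \<cdot>\<^bsub>L\<^esub> farr P (p X) = farr P (farr G (r (fobj F (Q X))) \<cdot>\<^bsub>C\<^esub> \<eta> (Q X))"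

lemma derived_unit_exists:
  assumes gen: "generates C L P"
    and F: "is_functor C C' F" and G: "is_functor C' C G"
    and \<eta>: "nat_trans C C id_fctor (G \<circ>\<^sub>F F) \<eta>"
    and resF: "resolves C L P L' (P' \<circ>\<^sub>F F) LF Q p"
    and resG: "resolves (op_cat C') (op_cat L') P' (op_cat L) (P \<circ>\<^sub>F G) RG R r"
  shows "\<exists>H. nat_trans L L id_fctor (RG \<circ>\<^sub>F LF) H \<and>
    (\<forall>X \<in> Obj C. derived_unit_at C L P F G \<eta> Q p r H X)"
proof -
  note rF = resolvesD[OF resF] and rG = resolvesD[OF resG, unfolded op_cat_simps is_functor_op is_iso_op]
  note Ps = functor_simps[OF rF(1)] and Ss = functor_simps[OF rF(3)] and P's = functor_simps[OF rG(1)]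
    and Ts = functor_simps[OF rG(3)] and Fs = functor_simps[OF F] and Gs = functor_simps[OF G]
    and \<eta>s = nat_trans_simps[OF \<eta>, simplified]
  interpret C: category C using F by (rule is_functor_category)
  interpret C': category C' using F by (rule is_functor_category)
  interpret L: category L using rF(1) by (rule is_functor_category)
  interpret L': category L' using rG(1) by (rule is_functor_category)
  define s where "s X = inv_arr L (farr P (p X))" for X
  note s = resolves_inverse[OF resF, folded s_def]
  \<comment> \<open>The transpose under the adjunction of the fibrant replacement of
    \<open>F (Q X)\<close>.\<close>
  define m where "m X = farr G (r (fobj F (Q X))) \<cdot>\<^bsub>C\<^esub> \<eta> (Q X)" for X
  have m: "m X \<in> Arr C" "Dom C (m X) = Q X" "Cod C (m X) = fobj G (R (fobj F (Q X)))"
    if "X \<in> Obj C" for X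
    using that by (simp_all add: m_def \<eta>s Gs Fs rF rG)
  have "\<exists>H. nat_trans L L id_fctor (RG \<circ>\<^sub>F LF) H \<and> (\<forall>X \<in> Obj C. H (fobj P X) = farr P (m X) \<cdot>\<^bsub>L\<^esub> s X)"
  proof (rule generates_nat_trans_extend[OF gen is_functor_id is_functor_comp[OF rF(3) rG(3)]])
    show "farr P (m X) \<cdot>\<^bsub>L\<^esub> s X \<in> hom L (fobj id_fctor (fobj P X)) (fobj (RG \<circ>\<^sub>F LF) (fobj P X))"
      if "X \<in> Obj C" for X
      using that by (simp add: hom_def m s Ps rF rG Fs)
    fix f assume f: "f \<in> Arr C"
    obtain q where q: "q \<in> Arr C" "Dom C q = Q (Dom C f)" "Cod C q = Q (Cod C f)"
      "p (Cod C f) \<cdot>\<^bsub>C\<^esub> q = f \<cdot>\<^bsub>C\<^esub> p (Dom C f)" "farr LF (farr P f) = farr P' (farr F q)"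
      using resolves_lift[OF resF f, unfolded comp_fctor_simps] by metis
    from q(1) have Fq: "farr F q \<in> Arr (op_cat C')" by (simp add: Fs)
    \<comment> \<open>A lift of \<open>F q\<close> in the opposite category is an extension of
      \<open>F q\<close> to the fibrant replacements. Thus \<open>RG (LF (P f))\<close> is
      represented by \<open>G t\<close>, and naturality reduces to a square in
      \<open>C\<close>.\<close>
    obtain t where "t \<in> Arr C'" "Cod C' t = R (Cod C' (farr F q))" "Dom C' t = R (Dom C' (farr F q))"
      "t \<cdot>\<^bsub>C'\<^esub> r (Dom C' (farr F q)) = r (Cod C' (farr F q)) \<cdot>\<^bsub>C'\<^esub> farr F q"
      "farr RG (farr P' (farr F q)) = farr P (farr G t)"
      using resolves_lift[OF resG Fq, unfolded op_cat_simps comp_fctor_simps] by metis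
    then have t: "t \<in> Arr C'" "Cod C' t = R (fobj F (Q (Cod C f)))" "Dom C' t = R (fobj F (Q (Dom C f)))"
      "t \<cdot>\<^bsub>C'\<^esub> r (fobj F (Q (Dom C f))) = r (fobj F (Q (Cod C f))) \<cdot>\<^bsub>C'\<^esub> farr F q"
      "farr RG (farr P' (farr F q)) = farr P (farr G t)"
      using q by (simp_all add: Fs)
    note fr = f q(1-3) t(1-3) \<eta>s(1-3) Gs(2-4) Fs(1-4) rF(4-7) rG(4-7)
    have "farr G t \<cdot>\<^bsub>C\<^esub> m (Dom C f) = farr G (t \<cdot>\<^bsub>C'\<^esub> r (fobj F (Q (Dom C f)))) \<cdot>\<^bsub>C\<^esub> \<eta> (Dom C q)"
      by (simp add: m_def fr Gs(6) C.Comp_assoc_Arr)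
    also have "\<dots> = farr G (r (fobj F (Q (Cod C f)))) \<cdot>\<^bsub>C\<^esub> (farr G (farr F q) \<cdot>\<^bsub>C\<^esub> \<eta> (Dom C q))"
      unfolding t(4) by (simp add: fr Gs(6) C.Comp_assoc_Arr)
    also have "\<dots> = m (Cod C f) \<cdot>\<^bsub>C\<^esub> q"
      unfolding \<eta>s(4)[OF q(1)] by (simp add: m_def fr C.Comp_assoc_Arr)
    finally have "farr G t \<cdot>\<^bsub>C\<^esub> m (Dom C f) = m (Cod C f) \<cdot>\<^bsub>C\<^esub> q" .
    then have "farr P (farr G t) \<cdot>\<^bsub>L\<^esub> farr P (m (Dom C f)) = farr P (m (Cod C f)) \<cdot>\<^bsub>L\<^esub> farr P q"
      by (simp add: f q t m Gs flip: Ps(6))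
    then have "(farr P (farr G t) \<cdot>\<^bsub>L\<^esub> farr P (m (Dom C f))) \<cdot>\<^bsub>L\<^esub> s (Dom C f) =
        farr P (m (Cod C f)) \<cdot>\<^bsub>L\<^esub> (s (Cod C f) \<cdot>\<^bsub>L\<^esub> farr P f)"
      unfolding s(6)[OF f q(1-4), symmetric] by (simp add: f q m s Ps L.Comp_assoc_Arr)
    then show "farr (RG \<circ>\<^sub>F LF) (farr P f) \<cdot>\<^bsub>L\<^esub> (farr P (m (Dom C f)) \<cdot>\<^bsub>L\<^esub> s (Dom C f)) =
        farr P (m (Cod C f)) \<cdot>\<^bsub>L\<^esub> s (Cod C f) \<cdot>\<^bsub>L\<^esub> farr id_fctor (farr P f)"
      by (simp add: q(5) t(5) f t(1-3) m s(1-3) Ps(2-4) Gs(2-4) L.Comp_assoc_Arr)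
  qed (rule L.category_axioms)
  then obtain H where H: "nat_trans L L id_fctor (RG \<circ>\<^sub>F LF) H"
    "\<And>X. X \<in> Obj C \<Longrightarrow> H (fobj P X) = farr P (m X) \<cdot>\<^bsub>L\<^esub> s X" by blast
  have "H (fobj P X) \<cdot>\<^bsub>L\<^esub> farr P (p X) = farr P (m X)" if "X \<in> Obj C" for X
    using that by (simp add: H(2) s m Ps rF L.Comp_assoc_Arr)
  with H(1) show ?thesis unfolding derived_unit_at_def m_def by blast
qed

text \<open>\<open>H\<close> is described only after precomposition with \<open>P (p X)\<close> and
  \<open>E\<close> only after postcomposition with \<open>P' (r Y)\<close>. Composing the triangle
  with \<open>LF (P (p X))\<close> and \<open>P' (r Y)\<close>, both invertible, therefore turns it
  into an equation between images under \<open>P'\<close>.\<close>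

lemma derived_triangle:
  assumes F: "is_functor C C' F" and G: "is_functor C' C G"
    and \<eta>: "nat_trans C C id_fctor (G \<circ>\<^sub>F F) \<eta>" and \<epsilon>: "nat_trans C' C' (F \<circ>\<^sub>F G) id_fctor \<epsilon>"
    and triangle: "\<And>X. X \<in> Obj C \<Longrightarrow> \<epsilon> (fobj F X) \<cdot>\<^bsub>C'\<^esub> farr F (\<eta> X) = Idt C' (fobj F X)"
    and resF: "resolves C L P L' (P' \<circ>\<^sub>F F) LF Q p"
    and resG: "resolves (op_cat C') (op_cat L') P' (op_cat L) (P \<circ>\<^sub>F G) RG R r"
    and H: "nat_trans L L id_fctor (RG \<circ>\<^sub>F LF) H" and E: "nat_trans L' L' (LF \<circ>\<^sub>F RG) id_fctor E"
    and HX: "\<And>X. X \<in> Obj C \<Longrightarrow> derived_unit_at C L P F G \<eta> Q p r H X"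
    and EY: "\<And>Y. Y \<in> Obj C' \<Longrightarrow>
      derived_unit_at (op_cat C') (op_cat L') P' G F \<epsilon> R r p E Y"
    and X: "X \<in> Obj C"
  shows "E (fobj LF (fobj P X)) \<cdot>\<^bsub>L'\<^esub> farr LF (H (fobj P X)) = Idt L' (fobj LF (fobj P X))"
proof -
  note rF = resolvesD[OF resF, simplified] and rG = resolvesD[OF resG, simplified]
  note Ps = functor_simps[OF rF(1)] and Ss = functor_simps[OF rF(3)] and P's = functor_simps[OF rG(1)]
    and Ts = functor_simps[OF rG(3)] and Fs = functor_simps[OF F] and Gs = functor_simps[OF G]
    and \<eta>s = nat_trans_simps[OF \<eta>, simplified] and \<epsilon>s = nat_trans_simps[OF \<epsilon>, simplified]
    and Hs = nat_trans_simps[OF H, simplified] and Es = nat_trans_simps[OF E, simplified]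
  interpret C: category C using F by (rule is_functor_category)
  interpret C': category C' using F by (rule is_functor_category)
  interpret L: category L using rF(1) by (rule is_functor_category)
  interpret L': category L' using rG(1) by (rule is_functor_category)
  define A where "A = Q X"
  define Y where "Y = fobj F A"
  define m where "m = farr G (r Y) \<cdot>\<^bsub>C\<^esub> \<eta> A"
  have A: "A \<in> Obj C" and Y: "Y \<in> Obj C'" using X by (simp_all add: A_def Y_def rF Fs)
  note XAY = X A Y
  have m: "m \<in> Arr C" "Dom C m = A" "Cod C m = fobj G (R Y)"
    using XAY by (simp_all add: m_def \<eta>s Gs rG Y_def)
  have pX: "p X \<in> Arr C" "Dom C (p X) = A" "Cod C (p X) = X" using X by (simp_all add: rF A_def)
  have LFX: "fobj LF (fobj P X) = fobj P' Y" using X by (simp add: rF A_def Y_def)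
  have EH: "E (fobj P' Y) \<in> Arr L'" "Cod L' (E (fobj P' Y)) = fobj P' Y"
    "Dom L' (E (fobj P' Y)) = fobj LF (fobj P (fobj G (R Y)))"
    "H (fobj P X) \<in> Arr L" "Dom L (H (fobj P X)) = fobj P X" "Cod L (H (fobj P X)) = fobj P (fobj G (R Y))"
    using XAY by (simp_all add: Hs Es Ps P's rG LFX)
  \<comment> \<open>Composing \<open>H\<close> with \<open>P (p X)\<close> gives \<open>P m\<close>,
    so \<open>LF\<close> has to be evaluated on \<open>P m\<close>; a lift of \<open>m\<close> does
    this.\<close>
  obtain q where q: "q \<in> Arr C" "Dom C q = Q A" "Cod C q = Q (fobj G (R Y))"
    "p (fobj G (R Y)) \<cdot>\<^bsub>C\<^esub> q = m \<cdot>\<^bsub>C\<^esub> p A" "farr LF (farr P m) = farr P' (farr F q)"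
    using resolves_lift[OF resF m(1), unfolded comp_fctor_simps m(2,3)] by metis
  have LFp: "farr LF (farr P (p X)) = farr P' (farr F (p A))"
    using X by (simp add: rF A_def)
  \<comment> \<open>Transposing \<open>m\<close> back returns \<open>r Y\<close>, by naturality of
    \<open>\<epsilon>\<close> and the triangle identity of the given adjunction.\<close>
  have "\<epsilon> (R Y) \<cdot>\<^bsub>C'\<^esub> farr F m = (\<epsilon> (R Y) \<cdot>\<^bsub>C'\<^esub> farr F (farr G (r Y))) \<cdot>\<^bsub>C'\<^esub> farr F (\<eta> A)"
    using XAY by (simp add: m_def \<eta>s \<epsilon>s Gs Fs rG Y_def C'.Comp_assoc_Arr)
  also have "\<dots> = (r Y \<cdot>\<^bsub>C'\<^esub> \<epsilon> Y) \<cdot>\<^bsub>C'\<^esub> farr F (\<eta> A)"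
    using \<epsilon>s(4)[of "r Y"] Y by (simp add: rG)
  also have "\<dots> = r Y"
    using XAY triangle[OF A] by (simp add: Y_def \<eta>s \<epsilon>s Gs Fs rG C'.Comp_assoc_Arr)
  finally have \<epsilon>m: "\<epsilon> (R Y) \<cdot>\<^bsub>C'\<^esub> farr F m = r Y" .
  have "(\<epsilon> (R Y) \<cdot>\<^bsub>C'\<^esub> farr F (p (fobj G (R Y)))) \<cdot>\<^bsub>C'\<^esub> farr F q = \<epsilon> (R Y) \<cdot>\<^bsub>C'\<^esub> farr F (m \<cdot>\<^bsub>C\<^esub> p A)"
    unfolding q(4)[symmetric] using Y q(1-3) by (simp add: rF rG \<epsilon>s Fs Gs C'.Comp_assoc_Arr)
  also have "\<dots> = (\<epsilon> (R Y) \<cdot>\<^bsub>C'\<^esub> farr F m) \<cdot>\<^bsub>C'\<^esub> farr F (p A)"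
    using XAY m by (simp add: rF rG \<epsilon>s Fs Gs C'.Comp_assoc_Arr)
  also have "\<dots> = r Y \<cdot>\<^bsub>C'\<^esub> farr F (p A)" unfolding \<epsilon>m ..
  finally have key: "(\<epsilon> (R Y) \<cdot>\<^bsub>C'\<^esub> farr F (p (fobj G (R Y)))) \<cdot>\<^bsub>C'\<^esub> farr F q = r Y \<cdot>\<^bsub>C'\<^esub> farr F (p A)" .
  have HX': "H (fobj P X) \<cdot>\<^bsub>L\<^esub> farr P (p X) = farr P m"
    using HX[OF X] by (simp add: derived_unit_at_def m_def A_def Y_def)
  have EY': "farr P' (r Y) \<cdot>\<^bsub>L'\<^esub> E (fobj P' Y) = farr P' (\<epsilon> (R Y) \<cdot>\<^bsub>C'\<^esub> farr F (p (fobj G (R Y))))"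
    using EY[OF Y] by (simp add: derived_unit_at_def)
  let ?u = "E (fobj P' Y) \<cdot>\<^bsub>L'\<^esub> farr LF (H (fobj P X))"
  have u: "?u \<in> Arr L'" "Dom L' ?u = fobj P' Y" "Cod L' ?u = fobj P' Y"
    using EH by (simp_all add: Ss LFX)
  have "farr P' (r Y) \<cdot>\<^bsub>L'\<^esub> (?u \<cdot>\<^bsub>L'\<^esub> farr LF (farr P (p X))) =
      (farr P' (r Y) \<cdot>\<^bsub>L'\<^esub> E (fobj P' Y)) \<cdot>\<^bsub>L'\<^esub> farr LF (H (fobj P X) \<cdot>\<^bsub>L\<^esub> farr P (p X))"
    using XAY EH pX by (simp add: Ss Ps P's rG L'.Comp_assoc_Arr)
  also have "\<dots> = farr P' ((\<epsilon> (R Y) \<cdot>\<^bsub>C'\<^esub> farr F (p (fobj G (R Y)))) \<cdot>\<^bsub>C'\<^esub> farr F q)"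
    unfolding HX' EY' q(5) using XAY q(1-3) by (simp add: P's Fs Gs \<epsilon>s rF rG)
  \<comment> \<open>\<open>key\<close> leaves \<open>P' (F (p A))\<close> on the right, and this
    equals \<open>LF (P (p X))\<close> because \<open>A\<close> is \<open>Q X\<close>. The two
    invertible factors can then be cancelled.\<close>
  also have "\<dots> = farr P' (r Y) \<cdot>\<^bsub>L'\<^esub> farr LF (farr P (p X))"
    unfolding key LFp using XAY by (simp add: P's Fs rF rG Y_def)
  finally have "?u \<cdot>\<^bsub>L'\<^esub> farr LF (farr P (p X)) = farr LF (farr P (p X))"
    using L'.iso_cancel_left[OF rG(8)[OF Y], of "?u \<cdot>\<^bsub>L'\<^esub> farr LF (farr P (p X))" "farr LF (farr P (p X))"]
      u XAY pX by (simp add: P's Ss Ps rG LFX)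
  then have "?u = Idt L' (fobj P' Y)"
    using L'.iso_cancel_right[OF functor_is_iso[OF rF(3) rF(8)[OF X]], of ?u "Idt L' (fobj P' Y)"]
      u XAY pX by (simp add: P's Ss Ps LFX)
  then show ?thesis unfolding LFX .
qed


theorem mainTheorem2:
  fixes C :: "('o, 'a) category" and C' :: "('o', 'a') category"
    and L :: "('u, 'v) category" and L' :: "('u', 'v') category"
    and P :: "('o, 'a, 'u, 'v) fctor" and P' :: "('o', 'a', 'u', 'v') fctor"
    and F :: "('o, 'a, 'o', 'a') fctor" and G :: "('o', 'a', 'o, 'a) fctor"
  assumes "model_category C Fib Cof W"
    and "model_category C' Fib' Cof' W'"
    and "is_localization TYPE('o + 'o' + 'u + 'u' + 'v + 'v') C W L P"
    and "is_localization TYPE('o + 'o' + 'u + 'u' + 'v + 'v') C' W' L' P'"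
    and "left_adjoint C C' F G"
    and "\<And>f. f \<in> W \<Longrightarrow> cofibrant C Cof (Dom C f) \<Longrightarrow> cofibrant C Cof (Cod C f) \<Longrightarrow> farr F f \<in> W'"
    and "\<And>f. f \<in> W' \<Longrightarrow> fibrant C' Fib' (Dom C' f) \<Longrightarrow> fibrant C' Fib' (Cod C' f) \<Longrightarrow> farr G f \<in> W"
  shows "\<exists>LF \<alpha> RG \<beta>.
    is_total_left_derived C L P C' L' P' F LF \<alpha> \<and>
    is_total_right_derived C' L' P' C L P G RG \<beta> \<and>
    left_adjoint L L' LF RG"
proof -
  let ?t = "TYPE('o + 'o' + 'u + 'u' + 'v + 'v')"
  let ?o = "Inl :: 'o \<Rightarrow> 'o + 'o' + 'u + 'u' + 'v + 'v'"
  let ?o' = "Inr \<circ> Inl :: 'o' \<Rightarrow> 'o + 'o' + 'u + 'u' + 'v + 'v'"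
  let ?u = "Inr \<circ> Inr \<circ> Inl :: 'u \<Rightarrow> 'o + 'o' + 'u + 'u' + 'v + 'v'"
  let ?u' = "Inr \<circ> Inr \<circ> Inr \<circ> Inl :: 'u' \<Rightarrow> 'o + 'o' + 'u + 'u' + 'v + 'v'"
  \<comment> \<open>Test arrows are pairs, so arrow types embed along the diagonal.\<close>
  let ?v = "(\<lambda>v. (v, v)) \<circ> Inr \<circ> Inr \<circ> Inr \<circ> Inr \<circ> Inl ::
    'v \<Rightarrow> ('o + 'o' + 'u + 'u' + 'v + 'v') \<times> ('o + 'o' + 'u + 'u' + 'v + 'v')"
  let ?v' = "(\<lambda>v. (v, v)) \<circ> Inr \<circ> Inr \<circ> Inr \<circ> Inr \<circ> Inr ::
    'v' \<Rightarrow> ('o + 'o' + 'u + 'u' + 'v + 'v') \<times> ('o + 'o' + 'u + 'u' + 'v + 'v')"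
  have inj: "inj ?o" "inj ?o'" "inj ?u" "inj ?u'" "inj ?v" "inj ?v'"
    by (auto intro!: injI)
  have FG: "is_functor C C' F" "is_functor C' C G" using assms(5) by (auto simp: left_adjoint_def)
  obtain \<eta> \<epsilon> where \<eta>: "nat_trans C C id_fctor (G \<circ>\<^sub>F F) \<eta>" and \<epsilon>: "nat_trans C' C' (F \<circ>\<^sub>F G) id_fctor \<epsilon>"
    and triF: "\<And>X. X \<in> Obj C \<Longrightarrow> \<epsilon> (fobj F X) \<cdot>\<^bsub>C'\<^esub> farr F (\<eta> X) = Idt C' (fobj F X)"
    and triG: "\<And>Y. Y \<in> Obj C' \<Longrightarrow> farr G (\<epsilon> Y) \<cdot>\<^bsub>C\<^esub> \<eta> (fobj G Y) = Idt C (fobj G Y)"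
    using assms(5) unfolding left_adjoint_def by blast
  have P: "is_functor C L P" "\<And>w. w \<in> W \<Longrightarrow> is_iso L (farr P w)"
    and P': "is_functor C' L' P'" "\<And>w. w \<in> W' \<Longrightarrow> is_iso L' (farr P' w)"
    using assms(3,4) by (auto simp: is_localization_def)
  have W: "W \<subseteq> Arr C" "W' \<subseteq> Arr C'" using assms(1,2) model_category.W_Arr by blast+
  note op_loc = is_localization_op[OF assms(4)]
  have gen: "generates C L P" "generates (op_cat C') (op_cat L') P'"
    using localization_generates[OF assms(3) W(1) inj(3,5,1)]
      localization_generates[OF op_loc _ inj(4,6,2)] W(2) by auto
  have "\<exists>LF Q p. resolves C L P L' (P' \<circ>\<^sub>F F) LF Q p"
  proof (rule model_category.resolution_exists[OF assms(1) is_functor_comp[OF FG(1) P'(1)] _ P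
        localization_lift[OF assms(3) inj(4,6)]])
    show "is_iso L' (farr (P' \<circ>\<^sub>F F) w)"
      if "w \<in> W" "cofibrant C Cof (Dom C w)" "cofibrant C Cof (Cod C w)" for w
      using assms(6)[OF that] P'(2) by simp
  qed
  then obtain LF Q p where resF: "resolves C L P L' (P' \<circ>\<^sub>F F) LF Q p" by blast
  have K: "is_functor (op_cat C') (op_cat L) (P \<circ>\<^sub>F G)" using is_functor_comp[OF FG(2) P(1)] by simp
  have opP': "is_functor (op_cat C') (op_cat L') P'" using P'(1) by simp
  have "\<exists>RG R r. resolves (op_cat C') (op_cat L') P' (op_cat L) (P \<circ>\<^sub>F G) RG R r"
  proof (rule model_category.resolution_exists[OF model_category_op[OF assms(2)] K _ opP' _
        localization_lift[OF op_loc inj(3,5)]], unfold cofibrant_op op_cat_simps is_iso_op)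
    show "is_iso L (farr (P \<circ>\<^sub>F G) w)"
      if "w \<in> W'" "fibrant C' Fib' (Cod C' w)" "fibrant C' Fib' (Dom C' w)" for w
      using assms(7)[OF that(1,3,2)] P(2) by simp
    show "is_iso L' (farr P' w)" if "w \<in> W'" for w using P'(2)[OF that] .
  qed
  then obtain RG R r where resG: "resolves (op_cat C') (op_cat L') P' (op_cat L) (P \<circ>\<^sub>F G) RG R r"
    by blast
  have left: "is_total_left_derived C L P C' L' P' F LF (\<lambda>X. farr (P' \<circ>\<^sub>F F) (p X))"
    by (rule resolves_total_left_derived[OF gen(1) resF])
  \<comment> \<open>The universal property of \<open>RG\<close> is that of a total left derived
    functor between the opposite categories.\<close>
  have right: "is_total_right_derived C' L' P' C L P G RG (\<lambda>Y. farr (P \<circ>\<^sub>F G) (r Y))"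
    by (rule is_total_left_derived_op[THEN iffD1, OF resolves_total_left_derived[OF gen(2) resG]])
  have opFG: "is_functor (op_cat C) (op_cat C') F" "is_functor (op_cat C') (op_cat C) G"
    using FG by simp_all
  have op\<epsilon>: "nat_trans (op_cat C') (op_cat C') id_fctor (F \<circ>\<^sub>F G) \<epsilon>" using \<epsilon> by simp
  have op\<eta>: "nat_trans (op_cat C) (op_cat C) (G \<circ>\<^sub>F F) id_fctor \<eta>" using \<eta> by simp
  have resF': "resolves (op_cat (op_cat C)) (op_cat (op_cat L)) P (op_cat (op_cat L')) (P' \<circ>\<^sub>F F) LF Q p"
    using resF by simp
  obtain H where H: "nat_trans L L id_fctor (RG \<circ>\<^sub>F LF) H"
    "\<And>X. X \<in> Obj C \<Longrightarrow> derived_unit_at C L P F G \<eta> Q p r H X"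
    using derived_unit_exists[OF gen(1) FG \<eta> resF resG] by blast
  \<comment> \<open>In the opposite categories \<open>G\<close> is left adjoint to \<open>F\<close>
    with unit \<open>\<epsilon>\<close>; the derived unit of that adjunction is the counit sought
    here.\<close>
  obtain E where E: "nat_trans (op_cat L') (op_cat L') id_fctor (LF \<circ>\<^sub>F RG) E"
    "\<And>Y. Y \<in> Obj C' \<Longrightarrow> derived_unit_at (op_cat C') (op_cat L') P' G F \<epsilon> R r p E Y"
    using derived_unit_exists[OF gen(2) opFG(2,1) op\<epsilon> resG resF', unfolded op_cat_simps(1)] by blast
  have E': "nat_trans L' L' (LF \<circ>\<^sub>F RG) id_fctor E" using E(1) by simp
  have opH: "nat_trans (op_cat L) (op_cat L) (RG \<circ>\<^sub>F LF) id_fctor H" using H(1) by simp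
  have objL: "Obj L = fobj P ` Obj C" "Obj L' = fobj P' ` Obj C'"
    using gen by (auto simp: generates_def bij_betw_def)
  have triLF: "E (fobj LF U) \<cdot>\<^bsub>L'\<^esub> farr LF (H U) = Idt L' (fobj LF U)" if U: "U \<in> Obj L" for U
  proof -
    from U obtain X where X: "X \<in> Obj C" "U = fobj P X" unfolding objL by blast
    show ?thesis
      unfolding X(2) by (rule derived_triangle[OF FG \<eta> \<epsilon> triF resF resG H(1) E' H(2) E(2) X(1)])
  qed
  have triRG: "farr RG (E V) \<cdot>\<^bsub>L\<^esub> H (fobj RG V) = Idt L (fobj RG V)" if V: "V \<in> Obj L'" for V
  proof -
    from V obtain Y where Y: "Y \<in> Obj C'" "V = fobj P' Y" unfolding objL by blast
    \<comment> \<open>The triangle for \<open>RG\<close> is the one for \<open>LF\<close> in the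
      opposite adjunction, with \<open>H\<close> and \<open>E\<close> exchanging roles.\<close>
    have "H (fobj RG V) \<cdot>\<^bsub>op_cat L\<^esub> farr RG (E V) = Idt (op_cat L) (fobj RG V)"
      unfolding Y(2)
      by (rule derived_triangle[OF opFG(2,1) op\<epsilon> op\<eta> _ resG resF' E(1) opH E(2)])
        (use triG H(2) Y(1) in simp_all)
    then show ?thesis by simp
  qed
  have "left_adjoint L L' LF RG"
    unfolding left_adjoint_def using H(1) E' triLF triRG resolvesD(3)[OF resF] resolvesD(3)[OF resG]
    by auto
  with left right show ?thesis by blast
qed

end
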